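(* Let $u_1,\dots,u_g$ be functions of $t=(t_1=x,\dots,t_g)$ on a simply connected domain $T$ whose generating function $\mathbf u(\xi)=\sum_{i=1}^gu_i\xi^i$ satisfies, identically in $\xi$, $$\mathbf u'''(\xi)+2u_1'(2-\mathbf u(\xi))-4(\xi^{-1}+u_1)\mathbf u'(\xi)=0,$$ $$\partial_k\mathbf u(\xi)=D_k(2-\mathbf u(\xi))\,\mathbf u'(\xi)-D_k(\mathbf u'(\xi))\,(2-\mathbf u(\xi)),\quad 1\le k\le g,$$ and let $\mu(\xi)$ be defined by $4\mu(\xi)=\mathbf u'(\xi)^2+2\mathbf u''(\xi)(2-\mathbf u(\xi))+4(\xi^{-1}+u_1)(2-\mathbf u(\xi))^2$ (its coefficients are constants). Let $\xi\neq0$ and $\alpha_1,\dots,\alpha_g$ be complex numbers, put $\alpha(\xi)=\sum_{i=1}^g\alpha_i\xi^i$, and suppose $4\alpha(\xi)^2=\mu(\xi)$ and $2-\mathbf u(t;\xi)\ne0$ for all $t\in T$. Then: (1) The function $$\Phi=\sqrt{2-\mathbf u(\xi)}\;\exp\bigl(2\alpha(\xi)F(\xi)\bigr)\exp\Bigl(-2\sum_{i=1}^gD_i(\alpha(\xi))\,t_i\Bigr)$$ is a common eigenfunction of $\mathcal L,\mathcal U_1,\dots,\mathcal U_g$ with eigenvalues $E=\xi^{-1},\alpha_1,\dots,\alpha_g$. (2) The space of common eigenfunctions of $\mathcal L,\mathcal U_1,\dots,\mathcal U_g$ with eigenvalues $E=\xi^{-1},\alpha_1,\dots,\alpha_g$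 is one-dimensional.
   Context: Prime denotes $\partial_x=\partial/\partial t_1$; $\partial_i=\partial/\partial t_i$ for $1\le i\le g$ and $\partial_{g+1}:=0$. $\mathcal L=\partial_x^2-u_1$ and $\mathcal U_i=\partial_x^2\partial_i-\frac12(u_1\partial_i+\partial_iu_1)-\frac14(u_i\partial_x+\partial_xu_i)-\partial_{i+1}$, where functions denote multiplication operators and products are compositions of operators. For a polynomial $f(\xi)=\sum_{j\ge0}f_j\xi^j$, $(D_kf)(\xi)=\frac12\sum_{j=0}^{k-1}f_j\xi^{j-k+1}$; derivatives of $\mathbf u(\xi)$ are taken coefficientwise. $F=F(t;\xi)$ is a function with $\partial_iF=\dfrac{D_i(2-\mathbf u(\xi))}{2-\mathbf u(\xi)}$, $1\le i\le g$; such a function exists (the system is compatible) and is unique up to an additive constant, so $\Phi$ is defined up to a nonzero multiplicative constant. Common eigenfunctions are considered as (smooth) functions on $T$. *)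

theory Defs
  imports "HOL-Analysis.Analysis" "HOL-Computational_Algebra.Polynomial" "HOL-Library.Function_Algebras"
begin

text \<open>The times \<open>t\<^sub>i\<close> are real or complex, and all functions are complex-valued. The class below treats
  both cases at once; the two instances are the only ones up to isomorphism (Gelfand--Mazur).\<close>

class time_scalar = real_normed_field + euclidean_space +
  fixes cplx :: "'a \<Rightarrow> complex"
  assumes cplx_add: "cplx (x + y) = cplx x + cplx y"
    and cplx_mult: "cplx (x * y) = cplx x * cplx y"
    and cplx_one: "cplx 1 = 1"
    and cplx_scaleR: "cplx (r *\<^sub>R x) = r *\<^sub>R cplx x"

instantiation real :: time_scalar
begin
definition cplx_real :: "real \<Rightarrow> complex" where "cplx_real = complex_of_real"
instance by standard (simp_all add: cplx_real_def scaleR_conv_of_real)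
end

instantiation complex :: time_scalar
begin
definition cplx_complex :: "complex \<Rightarrow> complex" where "cplx_complex z = z"
instance by standard (simp_all only: cplx_complex_def)
end

text \<open>Points are \<open>t :: 'k ^ 'g\<close> with \<open>g = CARD('g)\<close>; a bijection \<open>e\<close> from \<open>{1..g}\<close> to \<open>'g\<close>
  labels the coordinates, so that \<open>t\<^sub>i = t $ e i\<close>. For complex times and holomorphic \<open>f\<close> the
  value below is the complex partial derivative. The case \<open>i = g + 1\<close> gives \<open>\<partial>\<^bsub>g+1\<^esub> = 0\<close>.\<close>

definition pd :: "(nat \<Rightarrow> 'g) \<Rightarrow> nat \<Rightarrow> ('k::time_scalar ^ 'g \<Rightarrow> complex) \<Rightarrow> ('k ^ 'g \<Rightarrow> complex)" where
  "pd e i f = (\<lambda>t. if i \<in> {1..CARD('g)} then frechet_derivative f (at t) (axis (e i) 1) else 0)"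

text \<open>All iterated partial derivatives exist and are differentiable over the scalar field. For real
  times the second conjunct is automatic and this is \<open>C\<^sup>\<infinity>\<close>; for complex times it is the
  Cauchy--Riemann condition and this is holomorphy.\<close>

definition smooth :: "(nat \<Rightarrow> 'g) \<Rightarrow> ('k::time_scalar ^ 'g) set \<Rightarrow> ('k ^ 'g \<Rightarrow> complex) \<Rightarrow> bool" where
  "smooth e T f \<longleftrightarrow>
     (\<forall>is. set is \<subseteq> {1..CARD('g)} \<longrightarrow>
       (\<forall>t\<in>T. foldr (pd e) is f differentiable (at t) \<and>
          (\<forall>c v. frechet_derivative (foldr (pd e) is f) (at t) (c *s v)
                 = cplx c * frechet_derivative (foldr (pd e) is f) (at t) v)))"

definition genpoly :: "nat \<Rightarrow> (nat \<Rightarrow> complex) \<Rightarrow> complex poly" where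
  "genpoly g a = (\<Sum>i=1..g. monom (a i) i)"

definition D :: "nat \<Rightarrow> complex poly \<Rightarrow> complex \<Rightarrow> complex" where
  "D k f \<xi> = (1/2) * (\<Sum>j<k. coeff f j * \<xi> powi (int j - int k + 1))"

text \<open>\<open>U0 u t\<close> is \<open>\<^bold>u(t;\<xi>)\<close> as a polynomial in \<open>\<xi>\<close>; higher coefficientwise derivatives are
  obtained by applying \<open>U0\<close> to derivatives of the \<open>u\<^sub>i\<close>.\<close>

definition U0 :: "(nat \<Rightarrow> 'k::time_scalar ^ 'g \<Rightarrow> complex) \<Rightarrow> 'k ^ 'g \<Rightarrow> complex poly" where
  "U0 u t = genpoly CARD('g) (\<lambda>i. u i t)"

definition dU :: "(nat \<Rightarrow> 'g) \<Rightarrow> nat \<Rightarrow> (nat \<Rightarrow> 'k::time_scalar ^ 'g \<Rightarrow> complex) \<Rightarrow> 'k ^ 'g \<Rightarrow> complex poly" where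
  "dU e k u t = U0 (\<lambda>i. pd e k (u i)) t"

definition mu :: "(nat \<Rightarrow> 'g) \<Rightarrow> (nat \<Rightarrow> 'k::time_scalar ^ 'g \<Rightarrow> complex) \<Rightarrow> 'k ^ 'g \<Rightarrow> complex \<Rightarrow> complex" where
  "mu e u t \<xi> =
     ((poly (dU e 1 u t) \<xi>)^2
      + 2 * poly (U0 (\<lambda>i. pd e 1 (pd e 1 (u i))) t) \<xi> * (2 - poly (U0 u t) \<xi>)
      + 4 * (inverse \<xi> + u 1 t) * (2 - poly (U0 u t) \<xi>)^2) / 4"

definition Lop :: "(nat \<Rightarrow> 'g) \<Rightarrow> (nat \<Rightarrow> 'k::time_scalar ^ 'g \<Rightarrow> complex)
    \<Rightarrow> ('k ^ 'g \<Rightarrow> complex) \<Rightarrow> ('k ^ 'g \<Rightarrow> complex)" where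
  "Lop e u \<phi> = (\<lambda>t. pd e 1 (pd e 1 \<phi>) t - u 1 t * \<phi> t)"

definition Uop :: "(nat \<Rightarrow> 'g) \<Rightarrow> (nat \<Rightarrow> 'k::time_scalar ^ 'g \<Rightarrow> complex) \<Rightarrow> nat
    \<Rightarrow> ('k ^ 'g \<Rightarrow> complex) \<Rightarrow> ('k ^ 'g \<Rightarrow> complex)" where
  "Uop e u i \<phi> = (\<lambda>t. pd e 1 (pd e 1 (pd e i \<phi>)) t
       - (1/2) * (u 1 t * pd e i \<phi> t + pd e i (\<lambda>s. u 1 s * \<phi> s) t)
       - (1/4) * (u i t * pd e 1 \<phi> t + pd e 1 (\<lambda>s. u i s * \<phi> s) t)
       - pd e (i + 1) \<phi> t)"

text \<open>Functions on \<open>T\<close> are represented by total functions vanishing off \<open>T\<close>.\<close>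

definition eigenspace :: "(nat \<Rightarrow> 'g) \<Rightarrow> ('k::time_scalar ^ 'g) set \<Rightarrow> (nat \<Rightarrow> 'k ^ 'g \<Rightarrow> complex)
    \<Rightarrow> complex \<Rightarrow> (nat \<Rightarrow> complex) \<Rightarrow> ('k ^ 'g \<Rightarrow> complex) set" where
  "eigenspace e T u E \<alpha> = {\<phi>. smooth e T \<phi> \<and> (\<forall>t. t \<notin> T \<longrightarrow> \<phi> t = 0) \<and>
     (\<forall>t\<in>T. Lop e u \<phi> t = E * \<phi> t \<and> (\<forall>i\<in>{1..CARD('g)}. Uop e u i \<phi> t = \<alpha> i * \<phi> t))}"

text \<open>\<open>\<Phi>\<close> depends on the choice of a primitive \<open>F\<close> (at the given \<open>\<xi>\<close>) and of a continuous branch \<open>r\<close>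
  of the square root of \<open>2 - \<^bold>u(\<xi>)\<close> on \<open>T\<close>.\<close>

definition is_F :: "(nat \<Rightarrow> 'g) \<Rightarrow> ('k::time_scalar ^ 'g) set \<Rightarrow> (nat \<Rightarrow> 'k ^ 'g \<Rightarrow> complex)
    \<Rightarrow> complex \<Rightarrow> ('k ^ 'g \<Rightarrow> complex) \<Rightarrow> bool" where
  "is_F e T u \<xi> F \<longleftrightarrow> smooth e T F \<and>
     (\<forall>i\<in>{1..CARD('g)}. \<forall>t\<in>T. pd e i F t = D i (2 - U0 u t) \<xi> / (2 - poly (U0 u t) \<xi>))"

definition is_Phi :: "(nat \<Rightarrow> 'g) \<Rightarrow> ('k::time_scalar ^ 'g) set \<Rightarrow> (nat \<Rightarrow> 'k ^ 'g \<Rightarrow> complex)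
    \<Rightarrow> complex \<Rightarrow> (nat \<Rightarrow> complex) \<Rightarrow> ('k ^ 'g \<Rightarrow> complex) \<Rightarrow> bool" where
  "is_Phi e T u \<xi> \<alpha> \<Phi> \<longleftrightarrow> (\<exists>F r. is_F e T u \<xi> F \<and>
     continuous_on T r \<and> (\<forall>t\<in>T. (r t)^2 = 2 - poly (U0 u t) \<xi>) \<and>
     \<Phi> = (\<lambda>t. if t \<in> T then
            r t * exp (2 * poly (genpoly CARD('g) \<alpha>) \<xi> * F t)
                * exp (- 2 * (\<Sum>i=1..CARD('g). D i (genpoly CARD('g) \<alpha>) \<xi> * cplx (t $ e i)))
          else 0))"

definition cscale :: "complex \<Rightarrow> ('a \<Rightarrow> complex) \<Rightarrow> ('a \<Rightarrow> complex)" where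
  "cscale c f = (\<lambda>t. c * f t)"

global_interpretation cfun: vector_space "cscale :: complex \<Rightarrow> ('a \<Rightarrow> complex) \<Rightarrow> ('a \<Rightarrow> complex)"
  by unfold_locales (auto simp: cscale_def fun_eq_iff algebra_simps)

end

(*
  Write y = 2 - u(xi), A_i = D_i(2 - u) and q = 1/xi + u_1, so that the flow reads y_i = A_i y' - A_i' y.
  If phi'' = q phi, the U_i-eigenvalue equations say by induction on i that
    phi_i = A_i phi' - A_i' phi / 2 - 2 D_i(alpha) phi   for 1 <= i <= g + 1.
  For i = g + 1 the left side is 0 and A_{g+1} = y / (2 xi^g), D_{g+1}(alpha) = alpha(xi) / (2 xi^g),
  hence y phi' = (y'/2 + 2 alpha(xi)) phi. All partial logarithmic derivatives of a common eigenfunction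
  are therefore prescribed, and they are those of Phi; conversely the prescribed phi'/phi solves the Riccati
  equation of phi'' = q phi exactly when 4 alpha(xi)^2 = mu(xi). Existence of Phi needs a primitive of the
  form with coefficients A_i / y, which is closed by the commutation of the flows.
*)
theory Submission
  imports Defs
begin

text \<open>The obstacle is the global primitive \<open>F\<close>. Simple connectivity supplies
  homotopies that are merely continuous, so line integrals along their intermediate paths need not
  exist. They are replaced by the integrals \<open>J x y\<close> over short segments, an
  infinitesimal cocycle that can be pulled back along any continuous map. Derivatives are taken over
  the reals and scalar linearity is carried along separately, so that real and complex times share
  one proof. The second difficulty is that \<open>D k\<close> truncates a polynomial, and an
  identity known at the single value \<open>\<xi>\<close> cannot be truncated. The equations are
  therefore kept for all nonzero arguments, cleared of denominators and compared coefficientwise.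
  Three consequences are extracted: \<partial>_k u_1 = \<partial>_x u_k, a commutator relation
  between \<open>D i\<close> and \<open>D k\<close>, and a truncated stationary equation. The first
  and third close the induction on \<open>i\<close> and make \<open>mu\<close> constant; the second
  makes the form closed.\<close>

section \<open>Closed forms on simply connected sets\<close>

text \<open>The potential at \<open>a\<close> adds up \<open>j\<close> along a subdivision of the segment from \<open>0\<close> to \<open>a\<close>. For nearby
  \<open>a\<close> and \<open>b\<close> the cocycle identity on the small quadrilaterals between the two segments makes
  the difference telescope to \<open>j a b\<close>.\<close>

lemma cocycle_potential_convex:
  fixes C :: "'a::real_normed_vector set" and j :: "'a \<Rightarrow> 'a \<Rightarrow> 'b::ab_group_add"
  assumes C: "convex C" "bounded C" "0 \<in> C" and "d > 0"
    and j: "\<And>a b c. a \<in> C \<Longrightarrow> b \<in> C \<Longrightarrow> c \<in> C \<Longrightarrow> dist a b < d \<Longrightarrow> dist b c < d \<Longrightarrow> dist a c < d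
      \<Longrightarrow> j a b + j b c = j a c"
  obtains h r where "r > 0" "\<And>a b. a \<in> C \<Longrightarrow> b \<in> C \<Longrightarrow> dist a b < r \<Longrightarrow> h b - h a = j a b"
proof -
  obtain M where M: "M > 0" "\<And>x. x \<in> C \<Longrightarrow> norm x \<le> M"
    using C(2) bounded_pos by metis
  obtain N :: nat where N: "real N > M / (d/2)"
    using reals_Archimedean2 by blast
  with M \<open>d > 0\<close> have N0: "N > 0"
    by (smt (verit) divide_pos_pos gr0I half_gt_zero of_nat_0)
  \<comment> \<open>Steps along a segment and displacements between the two segments both stay below
    \<open>d / 2\<close>, which keeps the diagonals of the small quadrilaterals below
    \<open>d\<close>.\<close>
  have step: "M / N < d / 2"
    using N N0 \<open>d > 0\<close> by (simp add: field_simps)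
  define p where "p k a = (real k / real N) *\<^sub>R a" for k and a :: 'a
  have pC: "p k a \<in> C" if "a \<in> C" "k \<le> N" for k a
  proof -
    have "(1 - real k / N) *\<^sub>R 0 + (real k / N) *\<^sub>R a \<in> C"
      using C that N0 by (intro convexD) (auto simp: field_simps)
    then show ?thesis by (simp add: p_def)
  qed
  have p_step: "dist (p k a) (p (Suc k) a) < d/2" if "a \<in> C" for k a
  proof -
    have "p (Suc k) a - p k a = (1 / real N) *\<^sub>R a"
      by (simp add: p_def add_divide_distrib algebra_simps)
    then have "dist (p k a) (p (Suc k) a) = norm a / N"
      unfolding dist_norm norm_minus_commute[of "p k a"] by simp
    also have "\<dots> \<le> M / N" using M(2)[OF that] by (simp add: divide_right_mono)
    also note step
    finally show ?thesis .
  qed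
  have p_dist: "dist (p k a) (p k b) < d/2" if "dist a b < d/2" "k \<le> N" for k a b
  proof -
    have "dist (p k a) (p k b) = (real k / N) * dist a b"
      by (simp add: p_def dist_norm flip: scaleR_diff_right)
    also have "\<dots> \<le> 1 * dist a b"
      using that N0 by (intro mult_right_mono) auto
    finally show ?thesis using that by simp
  qed
  define h where "h a = (\<Sum>k<N. j (p k a) (p (Suc k) a))" for a
  show ?thesis
  proof (rule that[of "d/2" h])
    show "d / 2 > 0" using \<open>d > 0\<close> by simp
  next
    fix a b assume ab: "a \<in> C" "b \<in> C" "dist a b < d / 2"
    have quad: "j (p k b) (p (Suc k) b) - j (p k a) (p (Suc k) a)
        = j (p (Suc k) a) (p (Suc k) b) - j (p k a) (p k b)" if "k < N" for k
    proof -
      have k: "k \<le> N" "Suc k \<le> N" using that by auto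
      note P = pC[OF ab(1) k(1)] pC[OF ab(1) k(2)] pC[OF ab(2) k(1)] pC[OF ab(2) k(2)]
      note D = p_step[OF ab(1), of k] p_step[OF ab(2), of k] p_dist[OF ab(3) k(1)] p_dist[OF ab(3) k(2)]
      have diag: "dist (p k a) (p (Suc k) b) < d"
        using dist_triangle[of "p k a" "p (Suc k) b" "p k b"] D by linarith
      have "j (p k a) (p (Suc k) a) + j (p (Suc k) a) (p (Suc k) b) = j (p k a) (p (Suc k) b)"
        using P D diag \<open>d > 0\<close> by (intro j) auto
      moreover have "j (p k a) (p k b) + j (p k b) (p (Suc k) b) = j (p k a) (p (Suc k) b)"
        using P D diag \<open>d > 0\<close> by (intro j) auto
      ultimately show ?thesis by (simp add: algebra_simps)
    qed
    have "j 0 0 + j 0 0 = j 0 0" using C \<open>d > 0\<close> by (intro j) auto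
    then have j0: "j 0 0 = 0" by simp
    have "h b - h a = (\<Sum>k<N. j (p (Suc k) a) (p (Suc k) b) - j (p k a) (p k b))"
      unfolding h_def sum_subtractf[symmetric] by (intro sum.cong refl quad) auto
    also have "\<dots> = j (p N a) (p N b) - j (p 0 a) (p 0 b)"
      by (rule sum_lessThan_telescope)
    also have "\<dots> = j a b" using N0 j0 by (simp add: p_def)
    finally show "h b - h a = j a b" .
  qed
qed

text \<open>A Lebesgue number for the cover of the compact image by balls on which \<open>J\<close>
  is a cocycle, combined with uniform continuity of \<open>H\<close>, yields one radius valid
  throughout \<open>C\<close>. Intervals serve for paths, squares for homotopies.\<close>

lemma cocycle_potential_pullback:
  fixes C :: "'a::real_normed_vector set" and J :: "'e::metric_space \<Rightarrow> 'e \<Rightarrow> 'b::ab_group_add"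
  assumes C: "convex C" "compact C" "0 \<in> C" and H: "continuous_on C H" "H ` C \<subseteq> T"
    and J: "\<And>x. x \<in> T \<Longrightarrow> \<exists>r>0. \<forall>a\<in>ball x r. \<forall>b\<in>ball x r. \<forall>c\<in>ball x r. J a b + J b c = J a c"
  shows "\<exists>h r. r > 0 \<and> (\<forall>a\<in>C. \<forall>b\<in>C. dist a b < r \<longrightarrow> h b - h a = J (H a) (H b))"
proof -
  obtain R where R: "\<And>x. x \<in> T \<Longrightarrow> R x > 0"
    "\<And>x a b c. x \<in> T \<Longrightarrow> a \<in> ball x (R x) \<Longrightarrow> b \<in> ball x (R x) \<Longrightarrow> c \<in> ball x (R x) \<Longrightarrow> J a b + J b c = J a c"
    using J by metis
  have "compact (H ` C)" using C(2) H(1) by (rule compact_continuous_image[rotated])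
  moreover have "H ` C \<subseteq> \<Union>((\<lambda>x. ball x (R x)) ` T)" using H(2) R(1) by force
  ultimately obtain \<epsilon> where eps: "\<epsilon> > 0" "\<forall>x\<in>H ` C. \<exists>G\<in>(\<lambda>x. ball x (R x)) ` T. ball x \<epsilon> \<subseteq> G"
    using Heine_Borel_lemma[of "H ` C" "(\<lambda>x. ball x (R x)) ` T" thesis] by auto
  obtain d where d: "d > 0" "\<And>a b. a \<in> C \<Longrightarrow> b \<in> C \<Longrightarrow> dist b a < d \<Longrightarrow> dist (H b) (H a) < \<epsilon>"
    using compact_uniformly_continuous[OF H(1) C(2)] eps(1) unfolding uniformly_continuous_on_def by meson
  have "J (H a) (H b) + J (H b) (H c) = J (H a) (H c)"
    if "a \<in> C" "b \<in> C" "c \<in> C" "dist a b < d" "dist a c < d" for a b c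
  proof -
    have "\<exists>G\<in>(\<lambda>x. ball x (R x)) ` T. ball (H a) \<epsilon> \<subseteq> G"
      using eps(2) that(1) by (rule bspec[OF _ imageI])
    then obtain x where x: "x \<in> T" "ball (H a) \<epsilon> \<subseteq> ball x (R x)"
      by (elim bexE imageE) simp
    have "{H a, H b, H c} \<subseteq> ball (H a) \<epsilon>"
      using d(2)[of b a] d(2)[of c a] that eps(1) by (simp add: dist_commute)
    then have "{H a, H b, H c} \<subseteq> ball x (R x)" using x(2) by (rule subset_trans)
    then show ?thesis by (intro R(2)[OF x(1)]) blast+
  qed
  then show ?thesis
    using cocycle_potential_convex[OF C(1) compact_imp_bounded[OF C(2)] C(3) d(1), of "\<lambda>a b. J (H a) (H b)"]
    by metis
qed

lemma locally_constant_unit_interval: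
  fixes k :: "real \<Rightarrow> 'b"
  assumes "r > 0" "\<And>a b. a \<in> {0..1} \<Longrightarrow> b \<in> {0..1} \<Longrightarrow> dist a b < r \<Longrightarrow> k a = k b"
  shows "k 0 = k 1"
proof -
  obtain N :: nat where N: "real N > 1 / r" using reals_Archimedean2 by blast
  with \<open>r > 0\<close> have N0: "N > 0"
    by (smt (verit) divide_pos_pos gr0I of_nat_0)
  have "k 0 = k (real i / N)" if "i \<le> N" for i
    using that
  proof (induction i)
    case (Suc i)
    have "k (real i / N) = k (real (Suc i) / N)"
    proof (rule assms(2))
      have "dist (real i / N) (real (Suc i) / N) = 1 / N"
        by (simp add: dist_real_def add_divide_distrib)
      also have "1 / N < r" using N N0 \<open>r > 0\<close> by (simp add: field_simps)
      finally show "dist (real i / N) (real (Suc i) / N) < r" .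
    qed (use Suc N0 in \<open>auto simp: field_simps\<close>)
    with Suc show ?case by simp
  qed simp
  from this[of N] N0 show ?thesis by simp
qed

text \<open>\<open>c\<close> is the increment along \<open>p\<close> of the infinitesimal cocycle \<open>J\<close>, like a line integral.\<close>

definition path_value :: "('e::metric_space \<Rightarrow> 'e \<Rightarrow> 'b::ab_group_add) \<Rightarrow> (real \<Rightarrow> 'e) \<Rightarrow> 'b \<Rightarrow> bool" where
  "path_value J p c \<longleftrightarrow> (\<exists>h r. r > 0 \<and>
     (\<forall>a\<in>{0..1}. \<forall>b\<in>{0..1}. dist a b < r \<longrightarrow> h b - h a = J (p a) (p b)) \<and> c = h 1 - h 0)"

context
  fixes T :: "'e::real_normed_vector set" and J :: "'e \<Rightarrow> 'e \<Rightarrow> 'b::ab_group_add"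
  assumes J: "\<And>x. x \<in> T \<Longrightarrow> \<exists>r>0. \<forall>a\<in>ball x r. \<forall>b\<in>ball x r. \<forall>c\<in>ball x r. J a b + J b c = J a c"
begin

lemma path_value_exists:
  assumes "path p" "path_image p \<subseteq> T"
  obtains c where "path_value J p c"
proof -
  have "\<exists>h r. r > 0 \<and> (\<forall>a\<in>{0..1}. \<forall>b\<in>{0..1}. dist a b < r \<longrightarrow> h b - h a = J (p a) (p b))"
    by (rule cocycle_potential_pullback[OF _ _ _ assms[unfolded path_def path_image_def] J]) auto
  then show ?thesis using that unfolding path_value_def by blast
qed

lemma cocycle_refl: "x \<in> T \<Longrightarrow> J x x = 0"
  using J[of x] by (metis add_cancel_right_right centre_in_ball)

text \<open>A potential on the homotopy square agrees up to constants with potentials along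
  \<open>p\<close> and \<open>q\<close> on the sides belonging to them. On the other two sides the
  homotopy is stationary and every increment is \<open>J x x = 0\<close>, so the two increments are
  equal. With \<open>p = q\<close> this also shows independence of the potential chosen.\<close>

lemma path_value_homotopic:
  assumes hom: "homotopic_paths T p q" and p: "path_value J p c" and q: "path_value J q d"
  shows "c = d"
proof -
  obtain H where H: "continuous_on ({0..1} \<times> {0..1}) H" "H \<in> ({0..1} \<times> {0..1}) \<rightarrow> T"
      "\<And>x. x \<in> {0..1} \<Longrightarrow> H (0, x) = p x" "\<And>x. x \<in> {0..1} \<Longrightarrow> H (1, x) = q x"
      "\<And>t. t \<in> {0..1::real} \<Longrightarrow> H (t, 0) = pathstart p \<and> H (t, 1) = pathfinish p"
    using hom unfolding homotopic_paths by (auto simp: pathstart_def pathfinish_def)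
  have conv: "convex ({0..1::real} \<times> {0..1::real})"
    by (intro convex_Times convex_real_interval)
  have comp: "compact ({0..1::real} \<times> {0..1::real})"
    by (intro compact_Times compact_Icc)
  have "\<exists>h r. r > 0 \<and> (\<forall>a\<in>{0..1} \<times> {0..1}. \<forall>b\<in>{0..1} \<times> {0..1}. dist a b < r \<longrightarrow> h b - h a = J (H a) (H b))"
    using H(2) by (intro cocycle_potential_pullback[OF conv comp _ H(1) _ J, of T]) (auto simp: zero_prod_def)
  then obtain h r where r: "r > 0" and h: "\<And>a b. a \<in> {0..1} \<times> {0..1} \<Longrightarrow> b \<in> {0..1} \<times> {0..1}
      \<Longrightarrow> dist a b < r \<Longrightarrow> h b - h a = J (H a) (H b)"
    by blast
  have side: "c = h (s, 1) - h (s, 0)" if "s \<in> {0..1}" "path_value J p c" "\<And>x. x \<in> {0..1} \<Longrightarrow> H (s, x) = p x" for s p c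
  proof -
    obtain h' r' where h': "r' > 0" "\<And>a b. a \<in> {0..1} \<Longrightarrow> b \<in> {0..1} \<Longrightarrow> dist a b < r' \<Longrightarrow> h' b - h' a = J (p a) (p b)"
        "c = h' 1 - h' 0"
      using \<open>path_value J p c\<close> unfolding path_value_def by blast
    have "h' 0 - h (s, 0) = h' 1 - h (s, 1)"
    proof (rule locally_constant_unit_interval[where k = "\<lambda>a. h' a - h (s, a)" and r = "min r r'"])
      fix a b :: real assume ab: "a \<in> {0..1}" "b \<in> {0..1}" "dist a b < min r r'"
      have "h' b - h' a = J (p a) (p b)" using ab h' by auto
      moreover have "h (s, b) - h (s, a) = J (H (s, a)) (H (s, b))"
        using ab that by (intro h) (auto simp: dist_Pair_Pair)
      ultimately show "h' a - h (s, a) = h' b - h (s, b)"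
        using that ab by (simp add: algebra_simps)
    qed (use r h' in auto)
    then have "h' 1 = (h' 0 - h (s, 0)) + h (s, 1)" by simp
    then show ?thesis using h'(3) by simp
  qed
  have edge: "h (0, x) = h (1, x)" if "x = 0 \<or> x = 1" for x
  proof (rule locally_constant_unit_interval[where k = "\<lambda>s. h (s, x)" and r = r])
    fix a b :: real assume ab: "a \<in> {0..1}" "b \<in> {0..1}" "dist a b < r"
    have "h (b, x) - h (a, x) = J (H (a, x)) (H (b, x))"
      using ab that by (intro h) (auto simp: dist_Pair_Pair)
    also have "H (b, x) = H (a, x)" using that H(5)[OF ab(1)] H(5)[OF ab(2)] by auto
    also have "J (H (a, x)) (H (a, x)) = 0"
      using H(2) ab(1) that by (intro cocycle_refl) auto
    finally show "h (a, x) = h (b, x)" by simp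
  qed (rule r)
  show ?thesis
    using side[of 0, OF _ p] side[of 1, OF _ q] H(3,4) edge[of 0] edge[of 1] by auto
qed

text \<open>A potential along the joined path restricts to potentials along the two halves; halving
  the parameter shrinks distances, so the same radius works.\<close>

lemma path_value_join:
  assumes p: "path p" "path_image p \<subseteq> T" and q: "path q" "path_image q \<subseteq> T" "pathfinish p = pathstart q"
  obtains c d where "path_value J p c" "path_value J q d" "path_value J (p +++ q) (c + d)"
proof -
  have "path (p +++ q)" "path_image (p +++ q) \<subseteq> T"
    using p q by (auto simp: path_image_join)
  then obtain e where "path_value J (p +++ q) e" by (rule path_value_exists)
  then obtain h r where h: "r > 0" "\<And>a b. a \<in> {0..1} \<Longrightarrow> b \<in> {0..1} \<Longrightarrow> dist a b < r
      \<Longrightarrow> h b - h a = J ((p +++ q) a) ((p +++ q) b)" "e = h 1 - h 0"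
    unfolding path_value_def by blast
  have "path_value J p (h (1/2) - h 0)"
    unfolding path_value_def
  proof (intro exI[of _ "\<lambda>x. h (x / 2)"] exI[of _ r] conjI ballI impI)
    fix a b :: real assume ab: "a \<in> {0..1}" "b \<in> {0..1}" "dist a b < r"
    have "h (b/2) - h (a/2) = J ((p +++ q) (a/2)) ((p +++ q) (b/2))"
      using ab by (intro h) (auto simp: dist_real_def)
    then show "h (b/2) - h (a/2) = J (p a) (p b)"
      using ab by (simp add: joinpaths_def)
  qed (use h in auto)
  moreover have "path_value J q (h 1 - h (1/2))"
    unfolding path_value_def
  proof (intro exI[of _ "\<lambda>x. h ((x + 1) / 2)"] exI[of _ r] conjI ballI impI)
    fix a b :: real assume ab: "a \<in> {0..1}" "b \<in> {0..1}" "dist a b < r"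
    have eq: "(p +++ q) ((x + 1) / 2) = q x" if "x \<in> {0..1}" for x
      using that q(3) by (auto simp: joinpaths_def pathfinish_def pathstart_def field_simps)
    have "h ((b+1)/2) - h ((a+1)/2) = J ((p +++ q) ((a+1)/2)) ((p +++ q) ((b+1)/2))"
      using ab by (intro h) (auto simp: dist_real_def abs_if add_divide_distrib split: if_splits)
    then show "h ((b+1)/2) - h ((a+1)/2) = J (q a) (q b)"
      using ab by (simp add: eq)
  qed (use h in auto)
  moreover have "(h (1/2) - h 0) + (h 1 - h (1/2)) = e" by (simp add: h(3))
  ultimately show ?thesis using that \<open>path_value J (p +++ q) e\<close> by metis
qed

text \<open>\<open>F\<close> is the increment of \<open>J\<close> along a chosen path from
  \<open>t0\<close>. For \<open>y\<close> near \<open>x\<close>, the path to \<open>x\<close>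
  prolonged by the segment to \<open>y\<close> is homotopic to the chosen path to \<open>y\<close>.
  Increments are controlled from the centre \<open>x\<close> only, which is all that a derivative at
  \<open>x\<close> needs.\<close>

theorem cocycle_potential_simply_connected:
  assumes T: "open T" "simply_connected T"
  obtains F where "\<And>x. x \<in> T \<Longrightarrow> \<exists>r>0. \<forall>y\<in>ball x r. F y - F x = J x y"
proof (cases "T = {}")
  case True
  then show ?thesis using that by simp
next
  case False
  then obtain t0 where t0: "t0 \<in> T" by auto
  have "path_connected T" using T(2) by (rule simply_connected_imp_path_connected)
  then have "\<forall>t\<in>T. \<exists>p. path p \<and> path_image p \<subseteq> T \<and> pathstart p = t0 \<and> pathfinish p = t"
    using t0 unfolding path_connected_def by blast
  then obtain P where P: "\<And>t. t \<in> T \<Longrightarrow> path (P t)" "\<And>t. t \<in> T \<Longrightarrow> path_image (P t) \<subseteq> T"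
      "\<And>t. t \<in> T \<Longrightarrow> pathstart (P t) = t0" "\<And>t. t \<in> T \<Longrightarrow> pathfinish (P t) = t"
    by metis
  have unique: "c = d" if "path_value J p c" "path_value J q d" "path p" "path_image p \<subseteq> T" "path q" "path_image q \<subseteq> T"
      "pathstart q = pathstart p" "pathfinish q = pathfinish p" for p q c d
    using T(2) that path_value_homotopic[of p q c d] unfolding simply_connected_eq_homotopic_paths by metis
  have "\<forall>t\<in>T. \<exists>c. path_value J (P t) c"
    using P(1,2) path_value_exists by metis
  then obtain F where F: "\<And>t. t \<in> T \<Longrightarrow> path_value J (P t) (F t)" by metis
  show ?thesis
  proof (rule that)
    fix x assume x: "x \<in> T"
    obtain r where r: "r > 0" "\<And>a b c. a \<in> ball x r \<Longrightarrow> b \<in> ball x r \<Longrightarrow> c \<in> ball x r \<Longrightarrow> J a b + J b c = J a c"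
      using J[OF x] by metis
    obtain s where s: "s > 0" "ball x s \<subseteq> T" using T(1) x open_contains_ball by metis
    have "F y - F x = J x y" if y: "y \<in> ball x (min r s)" for y
    proof -
      have yT: "y \<in> T" using y s by auto
      let ?l = "linepath x y"
      have seg: "?l a \<in> ball x (min r s)" if "a \<in> {0..1}" for a
      proof -
        have "?l a \<in> path_image ?l" using that by (auto simp: path_image_def)
        then have "?l a \<in> closed_segment x y" by simp
        moreover have "closed_segment x y \<subseteq> ball x (min r s)"
          using y r(1) s(1) by (intro closed_segment_subset) auto
        ultimately show ?thesis by blast
      qed
      then have l: "path ?l" "path_image ?l \<subseteq> T" using s by (auto simp: path_image_def)
      have J0: "J x x = 0" using x by (rule cocycle_refl)
      \<comment> \<open>Inside the ball the cocycle identity makes \<open>J x\<close> itself a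
        potential along the segment.\<close>
      have "path_value J ?l (J x y)"
        unfolding path_value_def
      proof (intro exI[of _ "\<lambda>a. J x (?l a)"] exI[of _ 1] conjI ballI impI)
        fix a b :: real assume "a \<in> {0..1}" "b \<in> {0..1}"
        then have "J x (?l a) + J (?l a) (?l b) = J x (?l b)"
          using seg[of a] seg[of b] r(1) by (intro r(2)) auto
        then show "J x (?l b) - J x (?l a) = J (?l a) (?l b)" by (simp add: algebra_simps)
      qed (auto simp: linepath_def J0)
      moreover obtain c d where cd: "path_value J (P x) c" "path_value J ?l d" "path_value J (P x +++ ?l) (c + d)"
        using path_value_join[OF P(1,2)[OF x] l] P(4)[OF x] by auto
      ultimately have "d = J x y" using unique l by blast
      moreover have "c = F x" using unique[OF cd(1) F[OF x]] P(1,2)[OF x] by blast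
      moreover have "c + d = F y"
        using l P[OF x] P[OF yT] by (intro unique[OF cd(3) F[OF yT]]) (auto simp: path_image_join)
      ultimately show ?thesis by (simp add: algebra_simps)
    qed
    then show "\<exists>r>0. \<forall>y\<in>ball x r. F y - F x = J x y" using r(1) s(1) by (intro exI[of _ "min r s"]) auto
  qed
qed

end

section \<open>Primitives of closed one-forms, and symmetry of mixed derivatives\<close>

lemma has_derivative_along_line:
  fixes f :: "'a::real_normed_vector \<Rightarrow> 'b::real_normed_vector"
  assumes "(f has_derivative f') (at (x + s *\<^sub>R v))"
  shows "((\<lambda>s. f (x + s *\<^sub>R v)) has_vector_derivative f' v) (at s within A)"
proof -
  have "((\<lambda>s. x + s *\<^sub>R v) has_derivative (\<lambda>h. h *\<^sub>R v)) (at s within A)"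
    by (auto intro!: derivative_eq_intros)
  then have "((\<lambda>s. f (x + s *\<^sub>R v)) has_derivative (\<lambda>h. f' (h *\<^sub>R v))) (at s within A)"
    using assms by (rule has_derivative_compose)
  moreover have "f' (h *\<^sub>R v) = h *\<^sub>R f' v" for h
    using has_derivative_linear[OF assms] by (simp add: linear_scale)
  ultimately show ?thesis by (simp add: has_vector_derivative_def)
qed

text \<open>By symmetry of \<open>w'\<close> the derivative of the integrand in \<open>y\<close> is the derivative of \<open>s *\<^sub>R w (c + s *\<^sub>R (y - c))\<close> in \<open>s\<close>.\<close>

lemma closed_form_primitive_convex:
  fixes w :: "'a::euclidean_space \<Rightarrow> 'a \<Rightarrow>\<^sub>L 'b::banach" and w' :: "'a \<Rightarrow> 'a \<Rightarrow>\<^sub>L 'a \<Rightarrow>\<^sub>L 'b"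
  assumes U: "open U" "convex U" "c \<in> U" "y \<in> U"
    and w: "\<And>x. x \<in> U \<Longrightarrow> (w has_derivative w' x) (at x)"
    and w': "continuous_on U w'"
    and closed: "\<And>x a b. x \<in> U \<Longrightarrow> w' x a b = w' x b a"
  shows "((\<lambda>y. integral {0..1} (\<lambda>s. w (c + s *\<^sub>R (y - c)) (y - c))) has_derivative w y) (at y)"
proof -
  have inU: "c + s *\<^sub>R (z - c) \<in> U" if "z \<in> U" "s \<in> {0..1}" for z s
  proof -
    have "(1 - s) *\<^sub>R c + s *\<^sub>R z \<in> U" using that U by (intro convexD) auto
    then show ?thesis by (simp add: algebra_simps)
  qed
  have cw: "continuous_on U w"
    using w by (meson continuous_at_imp_continuous_on has_derivative_continuous)
  define G where "G z s = s *\<^sub>R w' (c + s *\<^sub>R (z - c)) (z - c) + w (c + s *\<^sub>R (z - c))" for z and s :: real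
  have der: "((\<lambda>z. w (c + s *\<^sub>R (z - c)) (z - c)) has_derivative blinfun_apply (G z s)) (at z within U)"
    if "z \<in> U" "s \<in> cbox 0 1" for z s
  proof -
    have "((\<lambda>z. c + s *\<^sub>R (z - c)) has_derivative (\<lambda>h. s *\<^sub>R h)) (at z within U)"
      by (auto intro!: derivative_eq_intros)
    moreover have "(w has_derivative w' (c + s *\<^sub>R (z - c))) (at (c + s *\<^sub>R (z - c)))"
      using that by (intro w inU) auto
    ultimately have 1: "((\<lambda>z. w (c + s *\<^sub>R (z - c))) has_derivative (\<lambda>h. w' (c + s *\<^sub>R (z - c)) (s *\<^sub>R h))) (at z within U)"
      by (rule has_derivative_compose)
    have 2: "((\<lambda>z. z - c) has_derivative (\<lambda>h. h)) (at z within U)"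
      by (auto intro!: derivative_eq_intros)
    have "((\<lambda>z. w (c + s *\<^sub>R (z - c)) (z - c)) has_derivative
        (\<lambda>h. w (c + s *\<^sub>R (z - c)) h + w' (c + s *\<^sub>R (z - c)) (s *\<^sub>R h) (z - c))) (at z within U)"
      by (rule bounded_bilinear.FDERIV[OF bounded_bilinear_blinfun_apply 1 2])
    moreover have "w (c + s *\<^sub>R (z - c)) h + w' (c + s *\<^sub>R (z - c)) (s *\<^sub>R h) (z - c) = G z s h" for h
      using closed[OF inU[OF that(1)], of s h "z - c"] that
      by (simp add: G_def blinfun.scaleR_right blinfun.scaleR_left blinfun.add_left)
    ultimately show ?thesis by simp
  qed
  have contG: "continuous_on (U \<times> cbox 0 1) (\<lambda>(z, s). G z s)"
    unfolding G_def split_def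
    by (intro continuous_intros continuous_on_compose2[OF w'] continuous_on_compose2[OF cw])
       (use inU in auto)
  have "((\<lambda>z. integral (cbox 0 1) (\<lambda>s. w (c + s *\<^sub>R (z - c)) (z - c))) has_derivative integral (cbox 0 1) (G y)) (at y within U)"
  proof (rule leibniz_rule[OF der _ contG U(4,2)])
    fix z assume "z \<in> U"
    then show "(\<lambda>s. w (c + s *\<^sub>R (z - c)) (z - c)) integrable_on cbox 0 1"
      by (intro integrable_continuous continuous_intros continuous_on_compose2[OF cw]) (use inU in auto)
  qed
  moreover have "(G y has_integral 1 *\<^sub>R w (c + 1 *\<^sub>R (y - c)) - 0 *\<^sub>R w (c + 0 *\<^sub>R (y - c))) {0..1}"
  proof (rule fundamental_theorem_of_calculus)
    fix s :: real assume s: "s \<in> {0..1}"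
    have "((\<lambda>s. w (c + s *\<^sub>R (y - c))) has_vector_derivative w' (c + s *\<^sub>R (y - c)) (y - c)) (at s within {0..1})"
      by (rule has_derivative_along_line[OF w[OF inU[OF U(4) s]]])
    then show "((\<lambda>s. s *\<^sub>R w (c + s *\<^sub>R (y - c))) has_vector_derivative G y s) (at s within {0..1})"
      unfolding G_def by (auto intro!: derivative_eq_intros)
  qed simp
  ultimately show ?thesis
    using at_within_open[OF U(4,1)] by (simp add: integral_unique)
qed

text \<open>\<open>J x y\<close> is the integral of the form over the segment from \<open>x\<close>
  to \<open>y\<close>. On a ball around \<open>x\<close> the function \<open>J x\<close> is a
  primitive by the convex case, so the integral over any segment there is a difference of its
  values. This gives the cocycle identity, and the potential of \<open>J\<close> is the
  primitive.\<close>

lemma closed_form_primitive_simply_connected: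
  fixes w :: "'a::euclidean_space \<Rightarrow> 'a \<Rightarrow>\<^sub>L 'b::banach" and w' :: "'a \<Rightarrow> 'a \<Rightarrow>\<^sub>L 'a \<Rightarrow>\<^sub>L 'b"
  assumes T: "open T" "simply_connected T"
    and w: "\<And>x. x \<in> T \<Longrightarrow> (w has_derivative w' x) (at x)"
    and w': "continuous_on T w'"
    and closed: "\<And>x a b. x \<in> T \<Longrightarrow> w' x a b = w' x b a"
  obtains F where "\<And>x. x \<in> T \<Longrightarrow> (F has_derivative w x) (at x)"
proof -
  define J where "J x y = integral {0..1} (\<lambda>s. w (x + s *\<^sub>R (y - x)) (y - x))" for x y
  have der: "(J c has_derivative w y) (at y)" if "ball x r \<subseteq> T" "c \<in> ball x r" "y \<in> ball x r" for x r c y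
    unfolding J_def
    by (rule closed_form_primitive_convex[of "ball x r" c y w w'])
       (use that w closed continuous_on_subset[OF w'] in \<open>auto simp del: mem_ball\<close>)
  have coc: "\<exists>r>0. \<forall>a\<in>ball x r. \<forall>b\<in>ball x r. \<forall>c\<in>ball x r. J a b + J b c = J a c" if x: "x \<in> T" for x
  proof -
    obtain r where r: "r > 0" "ball x r \<subseteq> T" using T(1) x open_contains_ball by metis
    have J: "J a b = J x b - J x a" if ab: "a \<in> ball x r" "b \<in> ball x r" for a b
    proof -
      have "((\<lambda>s. w (a + s *\<^sub>R (b - a)) (b - a)) has_integral J x (a + 1 *\<^sub>R (b - a)) - J x (a + 0 *\<^sub>R (b - a))) {0..1}"
      proof (rule fundamental_theorem_of_calculus)
        fix s :: real assume "s \<in> {0..1}"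
        then have "(1 - s) *\<^sub>R a + s *\<^sub>R b \<in> ball x r" using ab by (intro convexD) auto
        then have "a + s *\<^sub>R (b - a) \<in> ball x r" by (simp add: algebra_simps)
        then show "((\<lambda>s. J x (a + s *\<^sub>R (b - a))) has_vector_derivative w (a + s *\<^sub>R (b - a)) (b - a)) (at s within {0..1})"
          using r(1) by (intro has_derivative_along_line der[OF r(2)]) (simp_all only: centre_in_ball)
      qed simp
      then show ?thesis by (simp add: J_def[of a b] integral_unique)
    qed
    show ?thesis
    proof (intro exI[of _ r] conjI ballI r(1))
      fix a b c assume "a \<in> ball x r" "b \<in> ball x r" "c \<in> ball x r"
      then show "J a b + J b c = J a c" using J[of a b] J[of b c] J[of a c] by simp
    qed
  qed
  obtain F where F: "\<And>x. x \<in> T \<Longrightarrow> \<exists>r>0. \<forall>y\<in>ball x r. F y - F x = J x y"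
    using cocycle_potential_simply_connected[OF coc T] by metis
  show ?thesis
  proof (rule that)
    fix x assume x: "x \<in> T"
    obtain r where r: "r > 0" "\<And>y. y \<in> ball x r \<Longrightarrow> F y - F x = J x y" using F[OF x] by metis
    obtain s where s: "s > 0" "ball x s \<subseteq> T" using T(1) x open_contains_ball by metis
    have "((\<lambda>y. F x + J x y) has_derivative w x) (at x)"
      using has_derivative_add[OF has_derivative_const der[OF s(2)]] s(1) by simp
    then show "(F has_derivative w x) (at x)"
    proof (rule has_derivative_transform_within_open[of _ _ _ _ "ball x r"])
      fix y assume "y \<in> ball x r"
      from r(2)[OF this] show "F x + J x y = F y" by (simp add: algebra_simps)
    qed (use r in auto)
  qed
qed

text \<open>The increment of \<open>f\<close> over \<open>s *\<^sub>R v\<close> is an integral of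
  the \<open>v\<close>-derivative. Its derivative in direction \<open>w\<close> is computed once
  under the integral sign and once directly; differentiating both results in \<open>s\<close> at
  \<open>0\<close> gives the two mixed derivatives.\<close>

lemma mixed_derivatives_commute:
  fixes f :: "'a::real_normed_vector \<Rightarrow> 'b::banach"
  assumes S: "open S" "z \<in> S"
    and f: "\<And>x. x \<in> S \<Longrightarrow> (f has_derivative f' x) (at x)"
    and fv: "\<And>x. x \<in> S \<Longrightarrow> ((\<lambda>x. f' x v) has_derivative fv x) (at x)"
    and fw: "\<And>x. x \<in> S \<Longrightarrow> ((\<lambda>x. f' x w) has_derivative fw x) (at x)"
    and cont: "continuous_on S (\<lambda>x. fv x w)"
  shows "fv z w = fw z v"
proof -
  obtain r where r: "r > 0" "ball z r \<subseteq> S" using S open_contains_ball by metis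
  \<comment> \<open>The summand \<open>1\<close> keeps \<open>K\<close> positive when
    \<open>v\<close> and \<open>w\<close> vanish; the choice of \<open>\<rho>\<close> bounds all
    displacements by \<open>r / 2\<close>.\<close>
  define K where "K = norm v + norm w + 1"
  define \<rho> where "\<rho> = r / (2 * K)"
  have nvw: "K > 0" unfolding K_def by (smt (verit) norm_ge_zero)
  have \<rho>: "\<rho> > 0" using r nvw by (simp add: \<rho>_def)
  have inS: "z + a *\<^sub>R w + s *\<^sub>R v \<in> S" if "\<bar>a\<bar> \<le> \<rho>" "\<bar>s\<bar> \<le> \<rho>" for a s
  proof -
    have "norm (a *\<^sub>R w + s *\<^sub>R v) \<le> \<bar>a\<bar> * norm w + \<bar>s\<bar> * norm v"
      by (rule order_trans[OF norm_triangle_ineq]) simp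
    also have "\<dots> \<le> \<rho> * norm w + \<rho> * norm v" using that by (intro add_mono mult_right_mono) auto
    also have "\<dots> \<le> \<rho> * K" using \<rho> by (simp add: K_def algebra_simps)
    also have "\<dots> = r / 2" using nvw by (simp add: \<rho>_def)
    also have "\<dots> < r" using r by simp
    finally have "dist (z + (a *\<^sub>R w + s *\<^sub>R v)) z < r" by (simp add: dist_norm)
    then show ?thesis using r(2) by (auto simp: add.assoc dist_commute)
  qed
  have cfv: "continuous_on S (\<lambda>x. f' x v)"
    using fv by (meson continuous_at_imp_continuous_on has_derivative_continuous)
  let ?A = "{-\<rho>..\<rho>}"
  have ftc: "integral {0..s} (\<lambda>\<sigma>. f' (z + a *\<^sub>R w + \<sigma> *\<^sub>R v) v) = f (z + a *\<^sub>R w + s *\<^sub>R v) - f (z + a *\<^sub>R w)"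
    if "a \<in> ?A" "0 \<le> s" "s \<le> \<rho>" for a s
  proof -
    have "((\<lambda>\<sigma>. f' (z + a *\<^sub>R w + \<sigma> *\<^sub>R v) v) has_integral
        f (z + a *\<^sub>R w + s *\<^sub>R v) - f (z + a *\<^sub>R w + 0 *\<^sub>R v)) {0..s}"
      using that by (intro fundamental_theorem_of_calculus has_derivative_along_line f inS) auto
    then show ?thesis by (simp add: integral_unique)
  qed
  have fw_int: "integral {0..s} (\<lambda>\<sigma>. fv (z + \<sigma> *\<^sub>R v) w) = f' (z + s *\<^sub>R v) w - f' z w" if s: "0 \<le> s" "s \<le> \<rho>" for s
  proof -
    have swap: "z + a *\<^sub>R w + \<sigma> *\<^sub>R v = (z + \<sigma> *\<^sub>R v) + a *\<^sub>R w" for a \<sigma> by simp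
    have 1: "((\<lambda>a. integral (cbox 0 s) (\<lambda>\<sigma>. f' (z + a *\<^sub>R w + \<sigma> *\<^sub>R v) v)) has_vector_derivative
        integral (cbox 0 s) (\<lambda>\<sigma>. fv (z + 0 *\<^sub>R w + \<sigma> *\<^sub>R v) w)) (at 0 within ?A)"
    proof (rule leibniz_rule_vector_derivative)
      fix a \<sigma> assume a: "a \<in> ?A" "\<sigma> \<in> cbox 0 s"
      have "z + a *\<^sub>R w + \<sigma> *\<^sub>R v \<in> S" using a s by (intro inS) auto
      then show "((\<lambda>a. f' (z + a *\<^sub>R w + \<sigma> *\<^sub>R v) v) has_vector_derivative fv (z + a *\<^sub>R w + \<sigma> *\<^sub>R v) w) (at a within ?A)"
        unfolding swap by (intro has_derivative_along_line fv)
    next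
      fix a assume a: "a \<in> ?A"
      show "(\<lambda>\<sigma>. f' (z + a *\<^sub>R w + \<sigma> *\<^sub>R v) v) integrable_on cbox 0 s"
        using a s by (intro integrable_continuous continuous_on_compose2[OF cfv] continuous_intros) (auto intro!: inS)
    next
      show "continuous_on (?A \<times> cbox 0 s) (\<lambda>(a, \<sigma>). fv (z + a *\<^sub>R w + \<sigma> *\<^sub>R v) w)"
        unfolding split_def
        using s by (intro continuous_on_compose2[OF cont] continuous_intros) (auto intro!: inS)
    qed (use \<rho> in auto)
    have "((\<lambda>a. f (z + a *\<^sub>R w + s *\<^sub>R v) - f (z + a *\<^sub>R w)) has_vector_derivative
        f' (z + s *\<^sub>R v) w - f' z w) (at 0 within ?A)"
    proof (rule has_vector_derivative_diff)
      show "((\<lambda>a. f (z + a *\<^sub>R w + s *\<^sub>R v)) has_vector_derivative f' (z + s *\<^sub>R v) w) (at 0 within ?A)"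
        unfolding swap using inS[of 0 s] \<rho> s by (intro has_derivative_along_line) (auto intro!: f)
      show "((\<lambda>a. f (z + a *\<^sub>R w)) has_vector_derivative f' z w) (at 0 within ?A)"
        using S by (intro has_derivative_along_line) (auto intro!: f)
    qed
    then have 2: "((\<lambda>a. integral (cbox 0 s) (\<lambda>\<sigma>. f' (z + a *\<^sub>R w + \<sigma> *\<^sub>R v) v)) has_vector_derivative
        f' (z + s *\<^sub>R v) w - f' z w) (at 0 within ?A)"
      by (rule has_vector_derivative_transform[rotated 2]) (use s \<rho> ftc in auto)
    show ?thesis
      using vector_derivative_unique_within_closed_interval[of "-\<rho>" \<rho> 0, unfolded cbox_interval, OF _ _ 1 2] \<rho>
      by simp
  qed
  \<comment> \<open>Differentiation at \<open>0\<close> is one-sided, since \<open>fw_int\<close>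
    covers nonnegative \<open>s\<close> only; the derivative within the closed interval is still
    unique.\<close>
  have "((\<lambda>s. integral {0..s} (\<lambda>\<sigma>. fv (z + \<sigma> *\<^sub>R v) w)) has_vector_derivative fv (z + 0 *\<^sub>R v) w) (at 0 within {0..\<rho>})"
    using \<rho> inS[of 0] by (intro integral_has_vector_derivative continuous_on_compose2[OF cont] continuous_intros) auto
  moreover have "((\<lambda>s. integral {0..s} (\<lambda>\<sigma>. fv (z + \<sigma> *\<^sub>R v) w)) has_vector_derivative fw z v) (at 0 within {0..\<rho>})"
  proof (rule has_vector_derivative_transform)
    show "((\<lambda>s. f' (z + s *\<^sub>R v) w - f' z w) has_vector_derivative fw z v) (at 0 within {0..\<rho>})"
      using has_derivative_along_line[of "\<lambda>x. f' x w" "fw z" z 0 v] fw[OF S(2)]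
      by (auto intro!: derivative_eq_intros)
  qed (use fw_int \<rho> in auto)
  ultimately have "fv (z + 0 *\<^sub>R v) w = fw z v"
    by (rule vector_derivative_unique_within_closed_interval[of 0 \<rho> 0, unfolded cbox_interval, rotated 2])
       (use \<rho> in auto)
  then show ?thesis by simp
qed

section \<open>Functions of real or complex times\<close>

lemma cplx_0 [simp]: "cplx 0 = 0"
  using cplx_add[of 0 0] by simp

lemma linear_cplx: "linear cplx"
  by (rule linearI) (simp_all add: cplx_add cplx_scaleR)

lemma bounded_linear_cplx: "bounded_linear (cplx :: 'k::time_scalar \<Rightarrow> complex)"
  using linear_cplx linear_conv_bounded_linear by blast

text \<open>Differentiability over the scalar field, with partial derivatives \<open>b 1, \<dots>, b g\<close>.\<close>

definition kderiv :: "(nat \<Rightarrow> 'g::finite) \<Rightarrow> ('k::time_scalar ^ 'g \<Rightarrow> complex) \<Rightarrow> (nat \<Rightarrow> complex) \<Rightarrow> 'k ^ 'g \<Rightarrow> bool" where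
  "kderiv e f b t \<longleftrightarrow> (f has_derivative (\<lambda>v. \<Sum>i=1..CARD('g). b i * cplx (v $ e i))) (at t)"

lemma kderiv_const: "kderiv e (\<lambda>t. c) (\<lambda>i. 0) t"
  by (simp add: kderiv_def)

lemma kderiv_add: "kderiv e f a t \<Longrightarrow> kderiv e g b t \<Longrightarrow> kderiv e (\<lambda>t. f t + g t) (\<lambda>i. a i + b i) t"
  unfolding kderiv_def by (drule (1) has_derivative_add) (simp add: distrib_right sum.distrib)

lemma kderiv_mult:
  "kderiv e f a t \<Longrightarrow> kderiv e g b t \<Longrightarrow> kderiv e (\<lambda>t. f t * g t) (\<lambda>i. a i * g t + f t * b i) t"
  unfolding kderiv_def
  by (drule (1) has_derivative_mult) (simp add: algebra_simps sum.distrib sum_distrib_left)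

lemma kderiv_chain:
  assumes "kderiv e f b t" "(h has_field_derivative d) (at (f t))"
  shows "kderiv e (\<lambda>t. h (f t)) (\<lambda>i. d * b i) t"
proof -
  have "(h has_derivative (*) d) (at (f t))" using assms(2) by (simp add: has_field_derivative_def)
  from has_derivative_compose[OF assms(1)[unfolded kderiv_def] this] show ?thesis
    by (simp add: kderiv_def sum_distrib_left mult.assoc)
qed

lemma kderiv_imp_continuous: "kderiv e f b t \<Longrightarrow> isCont f t"
  unfolding kderiv_def by (rule has_derivative_continuous)

section \<open>Smooth functions and partial derivatives on an open time domain\<close>

locale time_domain =
  fixes e :: "nat \<Rightarrow> 'g::finite" and T :: "('k::time_scalar ^ 'g) set"
  assumes bij_e: "bij_betw e {1..CARD('g)} UNIV" and open_T: "open T"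
begin

lemma kderiv_unit_vector:
  assumes "i \<in> {1..CARD('g)}"
  shows "(\<Sum>j=1..CARD('g). b j * cplx (axis (e i) (1::'k) $ e j)) = b i"
proof -
  have "axis (e i) (1::'k) $ e j = (if j = i then 1 else 0)" if "j \<in> {1..CARD('g)}" for j
    using inj_on_eq_iff[OF bij_betw_imp_inj_on[OF bij_e] that assms] by (simp add: axis_def)
  then have "(\<Sum>j=1..CARD('g). b j * cplx (axis (e i) (1::'k) $ e j)) = (\<Sum>j=1..CARD('g). if j = i then b i else 0)"
    by (intro sum.cong refl) (simp add: cplx_one)
  also have "\<dots> = b i" using assms by simp
  finally show ?thesis .
qed

lemma pd_eqI: "kderiv e f b (t :: 'k ^ 'g) \<Longrightarrow> i \<in> {1..CARD('g)} \<Longrightarrow> pd e i f t = b i"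
proof -
  assume k: "kderiv e f b t" and i: "i \<in> {1..CARD('g)}"
  have "frechet_derivative f (at t) = (\<lambda>v. \<Sum>j=1..CARD('g). b j * cplx (v $ e j))"
    using k unfolding kderiv_def by (rule frechet_derivative_at[symmetric])
  from fun_cong[OF this, of "axis (e i) 1"] show ?thesis
    unfolding pd_def kderiv_unit_vector[OF i] using i by simp
qed

lemma kderiv_transform:
  "kderiv e f b t \<Longrightarrow> t \<in> T \<Longrightarrow> (\<And>s. s \<in> T \<Longrightarrow> f s = g s) \<Longrightarrow> kderiv e g b t"
  unfolding kderiv_def by (rule has_derivative_transform_within_open[OF _ open_T])

text \<open>The bridge to \<open>smooth\<close>: a real derivative that is homogeneous over the
  scalar field is determined by its values on the coordinate vectors, by basis expansion.\<close>

lemma kderiv_iff_differentiable: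
  fixes f :: "'k ^ 'g \<Rightarrow> complex"
  shows "(\<exists>b. kderiv e f b t) \<longleftrightarrow> f differentiable (at t) \<and>
    (\<forall>c v. frechet_derivative f (at t) (c *s v) = cplx c * frechet_derivative f (at t) v)" (is "?L \<longleftrightarrow> ?R")
proof
  assume ?L
  then obtain b where b: "kderiv e f b t" by blast
  then have "frechet_derivative f (at t) = (\<lambda>v. \<Sum>i=1..CARD('g). b i * cplx (v $ e i))"
    unfolding kderiv_def by (rule frechet_derivative_at[symmetric])
  moreover have "f differentiable (at t)" using b unfolding kderiv_def differentiable_def by blast
  ultimately show ?R by (simp add: cplx_mult sum_distrib_left mult.left_commute)
next
  assume R: ?R
  let ?d = "frechet_derivative f (at t)"
  have d: "(f has_derivative ?d) (at t)" using R frechet_derivative_works by blast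
  have "?d v = (\<Sum>i=1..CARD('g). ?d (axis (e i) 1) * cplx (v $ e i))" for v
  proof -
    have "v = (\<Sum>k\<in>UNIV. v $ k *s axis k 1)" by (rule basis_expansion[symmetric])
    also have "\<dots> = (\<Sum>i=1..CARD('g). v $ e i *s axis (e i) 1)"
      by (rule sum.reindex_bij_betw[OF bij_e, symmetric])
    finally have "?d v = ?d (\<Sum>i=1..CARD('g). v $ e i *s axis (e i) 1)"
      by (rule arg_cong)
    also have "\<dots> = (\<Sum>i=1..CARD('g). ?d (v $ e i *s axis (e i) 1))"
      by (rule linear_sum[OF has_derivative_linear[OF d]])
    also have "\<dots> = (\<Sum>i=1..CARD('g). ?d (axis (e i) 1) * cplx (v $ e i))"
      using R by (simp add: mult.commute)
    finally show ?thesis .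
  qed
  then have "?d = (\<lambda>v. \<Sum>i=1..CARD('g). ?d (axis (e i) 1) * cplx (v $ e i))" by (rule ext)
  with d have "kderiv e f (\<lambda>i. ?d (axis (e i) 1)) t" unfolding kderiv_def by (rule has_derivative_eq_rhs)
  then show ?L by blast
qed

text \<open>Finite levels allow induction on the number of derivatives and bootstrapping from one
  level to the next. Level \<open>0\<close> already asks for one derivative, matching the
  differentiability that \<open>smooth\<close> demands of every iterated derivative.\<close>

primrec smooth_upto :: "nat \<Rightarrow> ('k ^ 'g \<Rightarrow> complex) \<Rightarrow> bool" where
  "smooth_upto 0 f \<longleftrightarrow> (\<forall>t\<in>T. \<exists>b. kderiv e f b t)"
| "smooth_upto (Suc n) f \<longleftrightarrow> (\<forall>t\<in>T. \<exists>b. kderiv e f b t) \<and> (\<forall>i\<in>{1..CARD('g)}. smooth_upto n (pd e i f))"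

lemma smooth_upto_iff:
  "smooth_upto n f \<longleftrightarrow> (\<forall>is. set is \<subseteq> {1..CARD('g)} \<and> length is \<le> n \<longrightarrow> (\<forall>t\<in>T. \<exists>b. kderiv e (foldr (pd e) is f) b t))"
proof (induction n arbitrary: f)
  case (Suc n)
  show ?case (is "_ \<longleftrightarrow> ?R")
  proof
    assume *: "smooth_upto (Suc n) f"
    show ?R
    proof (intro allI impI)
      \<comment> \<open>\<open>foldr (pd e)\<close> applies the last index first, so the derivative
        peeled off \<open>f\<close> is the last entry of the list.\<close>
      fix "is" :: "nat list" assume "set is \<subseteq> {1..CARD('g)} \<and> length is \<le> Suc n"
      then show "\<forall>t\<in>T. \<exists>b. kderiv e (foldr (pd e) is f) b t"
        using * Suc.IH by (cases "is" rule: rev_cases) auto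
    qed
  next
    assume *: ?R
    have "smooth_upto n (pd e i f)" if "i \<in> {1..CARD('g)}" for i
      unfolding Suc.IH
    proof (intro allI impI)
      fix "is" :: "nat list" assume "set is \<subseteq> {1..CARD('g)} \<and> length is \<le> n"
      then show "\<forall>t\<in>T. \<exists>b. kderiv e (foldr (pd e) is (pd e i f)) b t"
        using that *[THEN spec, of "is @ [i]"] by auto
    qed
    moreover have "\<forall>t\<in>T. \<exists>b. kderiv e f b t" using *[THEN spec, of "[]"] by simp
    ultimately show "smooth_upto (Suc n) f" by simp
  qed
qed simp

lemma smooth_iff: "smooth e T f \<longleftrightarrow> (\<forall>n. smooth_upto n f)"
  unfolding smooth_def smooth_upto_iff kderiv_iff_differentiable by blast

lemma smooth_upto_kderiv: "smooth_upto n f \<Longrightarrow> t \<in> T \<Longrightarrow> kderiv e f (\<lambda>i. pd e i f t) t"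
proof -
  assume "smooth_upto n f" "t \<in> T"
  then obtain b where b: "kderiv e f b t" by (cases n) auto
  have "(\<lambda>v::'k^'g. \<Sum>i=1..CARD('g). b i * cplx (v $ e i)) = (\<lambda>v. \<Sum>i=1..CARD('g). pd e i f t * cplx (v $ e i))"
    by (intro ext sum.cong refl) (simp add: pd_eqI[OF b])
  then show ?thesis using b by (simp add: kderiv_def)
qed

lemma smooth_upto_cong:
  "(\<And>s. s \<in> T \<Longrightarrow> f s = g s) \<Longrightarrow> smooth_upto n f \<Longrightarrow> smooth_upto n g"
proof (induction n arbitrary: f g)
  case 0
  show ?case unfolding smooth_upto.simps
  proof
    fix t assume t: "t \<in> T"
    with 0 obtain b where "kderiv e f b t" by auto
    from kderiv_transform[OF this t 0(1)] show "\<exists>b. kderiv e g b t" by blast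
  qed
next
  case (Suc n)
  have k: "kderiv e g (\<lambda>i. pd e i f t) t" if "t \<in> T" for t
    using kderiv_transform[OF smooth_upto_kderiv[OF Suc.prems(2) that] that Suc.prems(1)] .
  have "smooth_upto n (pd e i g)" if "i \<in> {1..CARD('g)}" for i
  proof (rule Suc.IH)
    show "pd e i f s = pd e i g s" if "s \<in> T" for s
      using pd_eqI[OF k[OF that] \<open>i \<in> _\<close>] by simp
    show "smooth_upto n (pd e i f)" using Suc.prems(2) that by simp
  qed
  then show ?case using k by auto
qed

lemma smooth_upto_Suc_imp: "smooth_upto (Suc n) f \<Longrightarrow> smooth_upto n f"
  by (induction n arbitrary: f) auto

lemma smooth_upto_SucI:
  assumes "\<And>t. t \<in> T \<Longrightarrow> kderiv e f (\<lambda>i. b i t) t" "\<And>i. i \<in> {1..CARD('g)} \<Longrightarrow> smooth_upto n (b i)"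
  shows "smooth_upto (Suc n) f"
proof -
  have "smooth_upto n (pd e i f)" if "i \<in> {1..CARD('g)}" for i
    using assms(2)[OF that] by (rule smooth_upto_cong[rotated]) (simp add: pd_eqI[OF assms(1) that])
  then show ?thesis using assms(1) by auto
qed

lemma smooth_upto_const: "smooth_upto n (\<lambda>t. c)"
proof (induction n arbitrary: c)
  case 0
  then show ?case by (auto intro: kderiv_const)
next
  case (Suc n)
  show ?case by (rule smooth_upto_SucI[OF kderiv_const Suc])
qed

lemma smooth_upto_add: "smooth_upto n f \<Longrightarrow> smooth_upto n g \<Longrightarrow> smooth_upto n (\<lambda>t. f t + g t)"
proof (induction n arbitrary: f g)
  case 0
  then show ?case by (auto 4 4 intro: kderiv_add)
next
  case (Suc n)
  show ?case
  proof (rule smooth_upto_SucI)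
    show "kderiv e (\<lambda>t. f t + g t) (\<lambda>i. pd e i f t + pd e i g t) t" if "t \<in> T" for t
      using Suc.prems that by (intro kderiv_add smooth_upto_kderiv)
    show "smooth_upto n (\<lambda>t. pd e i f t + pd e i g t)" if "i \<in> {1..CARD('g)}" for i
      using Suc.prems that by (intro Suc.IH) auto
  qed
qed

lemma smooth_upto_mult: "smooth_upto n f \<Longrightarrow> smooth_upto n g \<Longrightarrow> smooth_upto n (\<lambda>t. f t * g t)"
proof (induction n arbitrary: f g)
  case 0
  then show ?case by (auto 4 4 intro: kderiv_mult)
next
  case (Suc n)
  show ?case
  proof (rule smooth_upto_SucI)
    show "kderiv e (\<lambda>t. f t * g t) (\<lambda>i. pd e i f t * g t + f t * pd e i g t) t" if "t \<in> T" for t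
      using Suc.prems that by (intro kderiv_mult smooth_upto_kderiv)
    show "smooth_upto n (\<lambda>t. pd e i f t * g t + f t * pd e i g t)" if "i \<in> {1..CARD('g)}" for i
    proof (intro smooth_upto_add Suc.IH)
      show "smooth_upto n (pd e i f)" "smooth_upto n (pd e i g)" using Suc.prems that by auto
      show "smooth_upto n f" "smooth_upto n g" using Suc.prems smooth_upto_Suc_imp by blast+
    qed
  qed
qed

text \<open>Serves functions whose derivatives involve the function itself, such as an inverse or a
  solution of a linear first-order system: level \<open>n\<close> of \<open>f\<close> gives level
  \<open>n\<close> of the \<open>b i\<close>, hence level \<open>Suc n\<close> of
  \<open>f\<close>.\<close>

lemma smooth_upto_bootstrap:
  assumes "\<And>t. t \<in> T \<Longrightarrow> kderiv e f (\<lambda>i. b i t) t"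
    and "\<And>i n. i \<in> {1..CARD('g)} \<Longrightarrow> smooth_upto n f \<Longrightarrow> smooth_upto n (b i)"
  shows "smooth e T f"
proof -
  have "smooth_upto n f" for n
  proof (induction n)
    case 0
    then show ?case using assms(1) by auto
  next
    case (Suc n)
    then show ?case using assms by (intro smooth_upto_SucI)
  qed
  then show ?thesis by (simp add: smooth_iff)
qed

lemma smooth_kderiv: "smooth e T f \<Longrightarrow> t \<in> T \<Longrightarrow> kderiv e f (\<lambda>i. pd e i f t) t"
  unfolding smooth_iff using smooth_upto_kderiv by blast

lemma smooth_pd: "smooth e T f \<Longrightarrow> i \<in> {1..CARD('g)} \<Longrightarrow> smooth e T (pd e i f)"
  unfolding smooth_iff by (metis smooth_upto.simps(2))

lemma smooth_const: "smooth e T (\<lambda>t. c)"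
  by (simp add: smooth_iff smooth_upto_const)

lemma smooth_add: "smooth e T f \<Longrightarrow> smooth e T g \<Longrightarrow> smooth e T (\<lambda>t. f t + g t)"
  by (simp add: smooth_iff smooth_upto_add)

lemma smooth_mult: "smooth e T f \<Longrightarrow> smooth e T g \<Longrightarrow> smooth e T (\<lambda>t. f t * g t)"
  by (simp add: smooth_iff smooth_upto_mult)

lemma smooth_diff: "smooth e T f \<Longrightarrow> smooth e T g \<Longrightarrow> smooth e T (\<lambda>t. f t - g t)"
  using smooth_add[OF _ smooth_mult[OF smooth_const[of "-1"]], of f g] by simp

lemma smooth_sum: "(\<And>i. i \<in> A \<Longrightarrow> smooth e T (f i)) \<Longrightarrow> smooth e T (\<lambda>t. \<Sum>i\<in>A. f i t)"
  by (induction A rule: infinite_finite_induct) (simp_all add: smooth_const smooth_add)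

lemma smooth_logarithmic:
  assumes "\<And>t. t \<in> T \<Longrightarrow> kderiv e f (\<lambda>i. b i t * f t) t" "\<And>i. i \<in> {1..CARD('g)} \<Longrightarrow> smooth e T (b i)"
  shows "smooth e T f"
proof (rule smooth_upto_bootstrap[OF assms(1)])
  show "smooth_upto n (\<lambda>t. b i t * f t)" if "i \<in> {1..CARD('g)}" "smooth_upto n f" for i n
    using assms(2)[OF that(1)] that(2) by (simp add: smooth_iff smooth_upto_mult)
qed

lemma kderiv_inverse: "kderiv e f b t \<Longrightarrow> f t \<noteq> 0 \<Longrightarrow> kderiv e (\<lambda>t. inverse (f t)) (\<lambda>i. - (inverse (f t) * inverse (f t)) * b i) t"
  by (rule kderiv_chain) (auto intro!: derivative_eq_intros simp: power2_eq_square)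

lemma smooth_inverse:
  assumes f: "smooth e T f" "\<And>t. t \<in> T \<Longrightarrow> f t \<noteq> 0"
  shows "smooth e T (\<lambda>t. inverse (f t))"
proof (rule smooth_upto_bootstrap)
  show "kderiv e (\<lambda>t. inverse (f t)) (\<lambda>i. - 1 * (inverse (f t) * inverse (f t)) * pd e i f t) t" if "t \<in> T" for t
    using kderiv_inverse[OF smooth_kderiv[OF f(1) that] f(2)[OF that]] by simp
  show "smooth_upto n (\<lambda>t. - 1 * (inverse (f t) * inverse (f t)) * pd e i f t)"
    if "i \<in> {1..CARD('g)}" "smooth_upto n (\<lambda>t. inverse (f t))" for i n
    using smooth_pd[OF f(1) that(1)] that(2)
    by (intro smooth_upto_mult smooth_upto_const) (auto simp: smooth_iff)
qed

lemma smooth_divide: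
  "smooth e T f \<Longrightarrow> smooth e T g \<Longrightarrow> (\<And>t. t \<in> T \<Longrightarrow> g t \<noteq> 0) \<Longrightarrow> smooth e T (\<lambda>t. f t / g t)"
  unfolding divide_inverse by (intro smooth_mult smooth_inverse)

lemma smooth_continuous_on: "smooth e T f \<Longrightarrow> continuous_on T f"
  by (meson continuous_at_imp_continuous_on kderiv_imp_continuous smooth_kderiv)

lemma pd_cong_on:
  assumes "smooth e T f" "\<And>s. s \<in> T \<Longrightarrow> f s = g s" "t \<in> T" "i \<in> {1..CARD('g)}"
  shows "pd e i g t = pd e i f t"
  using pd_eqI[OF kderiv_transform[OF smooth_kderiv[OF assms(1,3)] assms(3,2)] assms(4)] .

lemma pd_const: "pd e i (\<lambda>t::'k^'g. c) t = 0"
proof (cases "i \<in> {1..CARD('g)}")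
  case True
  then show ?thesis using pd_eqI[OF kderiv_const] by simp
qed (simp add: pd_def)

context
  fixes t i assumes t: "t \<in> T" and i: "i \<in> {1..CARD('g)}"
begin

lemma pd_add: "smooth e T f \<Longrightarrow> smooth e T g \<Longrightarrow> pd e i (\<lambda>t. f t + g t) t = pd e i f t + pd e i g t"
  using pd_eqI[OF kderiv_add[OF smooth_kderiv smooth_kderiv] i] t by blast

lemma pd_mult: "smooth e T f \<Longrightarrow> smooth e T g \<Longrightarrow> pd e i (\<lambda>t. f t * g t) t = pd e i f t * g t + f t * pd e i g t"
  using pd_eqI[OF kderiv_mult[OF smooth_kderiv smooth_kderiv] i] t by blast

lemma pd_cmult: "smooth e T f \<Longrightarrow> pd e i (\<lambda>t. c * f t) t = c * pd e i f t"
  using pd_mult[OF smooth_const] by (simp add: pd_const)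

lemma pd_diff: "smooth e T f \<Longrightarrow> smooth e T g \<Longrightarrow> pd e i (\<lambda>t. f t - g t) t = pd e i f t - pd e i g t"
  using pd_add[OF _ smooth_mult[OF smooth_const[of "-1"]], of f g] pd_cmult[of g "-1"] by simp

lemma pd_sum: "(\<And>j. j \<in> A \<Longrightarrow> smooth e T (f j)) \<Longrightarrow> pd e i (\<lambda>t. \<Sum>j\<in>A. f j t) t = (\<Sum>j\<in>A. pd e i (f j) t)"
  by (induction A rule: infinite_finite_induct) (simp_all add: pd_const pd_add smooth_sum)

lemma pd_divide:
  assumes "smooth e T f" "smooth e T g" "\<And>t. t \<in> T \<Longrightarrow> g t \<noteq> 0"
  shows "pd e i (\<lambda>t. f t / g t) t = (pd e i f t * g t - f t * pd e i g t) / (g t)\<^sup>2"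
proof -
  have "pd e i (\<lambda>t. inverse (g t)) t = - (inverse (g t) * inverse (g t)) * pd e i g t"
    by (rule pd_eqI[OF kderiv_inverse i]) (use assms t in \<open>auto intro: smooth_kderiv\<close>)
  then have "pd e i (\<lambda>t. f t * inverse (g t)) t = pd e i f t * inverse (g t) - f t * (inverse (g t) * inverse (g t)) * pd e i g t"
    using pd_mult[OF assms(1) smooth_inverse[OF assms(2,3)]] by simp
  then show ?thesis
    using assms(3)[OF t] by (simp add: divide_inverse power2_eq_square algebra_simps)
qed

lemma pd_commute:
  assumes "smooth e T f" "j \<in> {1..CARD('g)}"
  shows "pd e i (pd e j f) t = pd e j (pd e i f) t"
proof -
  let ?lin = "\<lambda>f x (v :: 'k ^ 'g). \<Sum>k=1..CARD('g). pd e k f x * cplx (v $ e k)"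
  have unit: "?lin f x (axis (e k) 1) = pd e k f x" if "k \<in> {1..CARD('g)}" for k x and f :: "'k^'g \<Rightarrow> complex"
    using kderiv_unit_vector[OF that, of "\<lambda>k. pd e k f x"] .
  have der: "(f has_derivative ?lin f x) (at x)" if "smooth e T f" "x \<in> T" for f x
    using smooth_kderiv[OF that] by (simp add: kderiv_def)
  have "?lin (pd e j f) t (axis (e i) 1) = ?lin (pd e i f) t (axis (e j) 1)"
  proof (rule mixed_derivatives_commute[OF open_T t der[OF assms(1)]])
    show "((\<lambda>x. ?lin f x (axis (e j) 1)) has_derivative ?lin (pd e j f) x) (at x)" if "x \<in> T" for x
      unfolding unit[OF assms(2)] using der[OF smooth_pd[OF assms] that] .
    show "((\<lambda>x. ?lin f x (axis (e i) 1)) has_derivative ?lin (pd e i f) x) (at x)" if "x \<in> T" for x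
      unfolding unit[OF i] using der[OF smooth_pd[OF assms(1) i] that] .
    show "continuous_on T (\<lambda>x. ?lin (pd e j f) x (axis (e i) 1))"
      unfolding unit[OF i] using assms i by (intro smooth_continuous_on smooth_pd)
  qed
  then show ?thesis unfolding unit[OF i] unit[OF assms(2)] .
qed

end

lemma kderiv_zero_constant:
  assumes "connected T" "\<And>t. t \<in> T \<Longrightarrow> kderiv e f (\<lambda>i. 0) t" "s \<in> T" "t \<in> T"
  shows "f s = f t"
  using has_derivative_zero_unique_connected[OF open_T assms(1) _ assms(3,4), of f] assms(2)
  by (simp add: kderiv_def)

text \<open>Near \<open>t\<close> the quotient \<open>r s / r t\<close> has positive real part, so
  it is the principal root of \<open>y s / y t\<close>, and \<open>csqrt\<close> is differentiable
  at \<open>1\<close>.\<close>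

lemma kderiv_continuous_sqrt:
  assumes y: "kderiv e y b t" "t \<in> T" "y t \<noteq> 0" and r: "continuous_on T r" "\<And>s. s \<in> T \<Longrightarrow> (r s)\<^sup>2 = y s"
  shows "kderiv e r (\<lambda>i. b i / (2 * y t) * r t) t"
proof -
  have rt: "r t \<noteq> 0" using r(2)[OF y(2)] y(3) by auto
  have "isCont r t" using r(1) open_T y(2) continuous_on_eq_continuous_at by blast
  then have "isCont (\<lambda>s. Re (r s / r t)) t" unfolding divide_inverse by (intro isCont_Re continuous_intros)
  then have "((\<lambda>s. Re (r s / r t)) \<longlongrightarrow> Re (r t / r t)) (nhds t)"
    using tendsto_at_iff_tendsto_nhds[of "\<lambda>s. Re (r s / r t)" t] unfolding isCont_def by blast
  then have "eventually (\<lambda>s. Re (r s / r t) > 0) (nhds t)"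
    by (rule order_tendstoD(1)) (simp add: rt)
  moreover have "eventually (\<lambda>s. s \<in> T) (nhds t)" using open_T y(2) eventually_nhds by blast
  ultimately have "eventually (\<lambda>s. r t * csqrt (y s / y t) = r s) (nhds t)"
  proof eventually_elim
    case (elim s)
    have "y s / y t = (r s / r t)\<^sup>2" using r(2) elim y(2) by (simp add: power_divide)
    then show ?case using elim rt csqrt_square[of "r s / r t"] by simp
  qed
  then obtain S where S: "open S" "t \<in> S" "\<And>s. s \<in> S \<Longrightarrow> r t * csqrt (y s / y t) = r s"
    unfolding eventually_nhds by blast
  have "((\<lambda>z. r t * csqrt (z / y t)) has_field_derivative r t * (inverse (2 * csqrt (y t / y t)) * inverse (y t))) (at (y t))"
    using y(3) by (auto intro!: derivative_eq_intros) (simp add: divide_inverse)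
  from kderiv_chain[OF y(1) this]
  have "kderiv e (\<lambda>s. r t * csqrt (y s / y t)) (\<lambda>i. b i / (2 * y t) * r t) t"
    using y(3) by (simp add: field_simps)
  then show ?thesis
    unfolding kderiv_def using S by (rule has_derivative_transform_within_open)
qed

lemma closed_form_primitive:
  assumes T: "simply_connected T"
    and b: "\<And>i. i \<in> {1..CARD('g)} \<Longrightarrow> smooth e T (b i)"
    and closed: "\<And>i k t. i \<in> {1..CARD('g)} \<Longrightarrow> k \<in> {1..CARD('g)} \<Longrightarrow> t \<in> T \<Longrightarrow> pd e k (b i) t = pd e i (b k) t"
  obtains F where "smooth e T F" "\<And>t. t \<in> T \<Longrightarrow> kderiv e F (\<lambda>i. b i t) t"
proof -
  let ?I = "{1..CARD('g)}"
  \<comment> \<open>\<open>M i z\<close> is the linear form sending \<open>v\<close> to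
    \<open>z * cplx (v $ e i)\<close>. It is bounded linear in \<open>z\<close>, so forms assembled
    from it inherit derivatives and continuity from their coefficient functions.\<close>
  define M :: "nat \<Rightarrow> complex \<Rightarrow>\<^sub>L ('k ^ 'g) \<Rightarrow>\<^sub>L complex"
    where "M i = Blinfun (\<lambda>z. blinfun_mult_right z o\<^sub>L Blinfun (\<lambda>v. cplx (v $ e i)))" for i
  have M: "M i z v = z * cplx (v $ e i)" for i z v
  proof -
    have "bounded_linear (\<lambda>v::'k^'g. cplx (v $ e i))"
      by (rule bounded_linear_compose[OF bounded_linear_cplx bounded_linear_vec_nth])
    moreover have "bounded_linear (\<lambda>z::complex. blinfun_mult_right z o\<^sub>L Blinfun (\<lambda>v::'k^'g. cplx (v $ e i)))"
      by (intro bounded_linear_intros)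
    ultimately show ?thesis by (simp add: M_def bounded_linear_Blinfun_apply)
  qed
  define w where "w x = (\<Sum>i\<in>?I. M i (b i x))" for x
  define w' where "w' x = (\<Sum>i\<in>?I. \<Sum>j\<in>?I. M i o\<^sub>L M j (pd e j (b i) x))" for x
  have w: "w x v = (\<Sum>i\<in>?I. b i x * cplx (v $ e i))" for x v
    by (simp add: w_def M blinfun.sum_left)
  have w': "w' x v a = (\<Sum>i\<in>?I. \<Sum>j\<in>?I. pd e j (b i) x * cplx (v $ e j) * cplx (a $ e i))" for x v a
    by (simp add: w'_def M blinfun.sum_left)
  have dw: "(w has_derivative w' x) (at x)" if x: "x \<in> T" for x
  proof -
    have "((\<lambda>x. M i (b i x)) has_derivative (\<lambda>v. M i (\<Sum>j\<in>?I. pd e j (b i) x * cplx (v $ e j)))) (at x)" if "i \<in> ?I" for i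
      using smooth_kderiv[OF b[OF that] x]
      unfolding kderiv_def by (rule bounded_linear.has_derivative[OF blinfun.bounded_linear_right])
    then have "(w has_derivative (\<lambda>v. \<Sum>i\<in>?I. M i (\<Sum>j\<in>?I. pd e j (b i) x * cplx (v $ e j)))) (at x)"
      unfolding w_def by (rule has_derivative_sum)
    moreover have "(\<lambda>v. \<Sum>i\<in>?I. M i (\<Sum>j\<in>?I. pd e j (b i) x * cplx (v $ e j))) = w' x"
      by (intro ext blinfun_eqI) (simp add: w'_def M blinfun.sum_left sum_distrib_right)
    ultimately show ?thesis by simp
  qed
  have cont: "continuous_on T w'"
    unfolding w'_def
    by (intro continuous_intros smooth_continuous_on smooth_pd b) auto
  have sym: "w' x v a = w' x a v" if "x \<in> T" for x v a
    unfolding w' by (subst sum.swap) (intro sum.cong refl, simp add: closed that)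
  obtain F where F: "\<And>x. x \<in> T \<Longrightarrow> (F has_derivative w x) (at x)"
    using closed_form_primitive_simply_connected[OF open_T T dw cont sym] by metis
  have k: "kderiv e F (\<lambda>i. b i x) x" if "x \<in> T" for x
    using F[OF that] unfolding kderiv_def w .
  have "smooth e T F"
    by (rule smooth_upto_bootstrap[OF k]) (use b in \<open>simp_all add: smooth_iff\<close>)
  then show ?thesis using k by (rule that)
qed

end

section \<open>The operators \<open>D\<^sub>k\<close> on polynomials\<close>

text \<open>The recursion behind every passage from \<open>k\<close> to \<open>k + 1\<close> below:
  for \<open>A\<close>, for \<open>alpha_D\<close> and for the truncated stationary
  equation.\<close>

lemma D_Suc:
  assumes "\<xi> \<noteq> 0"
  shows "D (Suc k) f \<xi> = D k f \<xi> / \<xi> + coeff f k / 2"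
proof -
  have "\<xi> powi (int j - int (Suc k) + 1) = \<xi> powi (int j - int k + 1) / \<xi>" for j
    using power_int_diff[of \<xi> "int j - int k + 1" 1] assms by simp
  then show ?thesis
    using assms by (simp add: D_def sum_divide_distrib algebra_simps del: of_nat_Suc)
qed

lemma D_1: "D (Suc 0) f \<xi> = coeff f 0 / 2"
  by (simp add: D_def)

text \<open>Clearing the negative powers turns \<open>D\<close> into truncation, so that its
  products and degrees can be studied inside the polynomial ring.\<close>

lemma D_eq_poly_cutoff:
  assumes "\<xi> \<noteq> 0"
  shows "2 * \<xi> ^ m * D (Suc m) f \<xi> = poly (poly_cutoff (Suc m) f) \<xi>"
proof (induction m)
  case 0
  have "poly_cutoff (Suc 0) f = [:coeff f 0:]"
    by (auto simp: poly_eq_iff coeff_poly_cutoff coeff_pCons split: nat.splits)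
  then show ?case by (simp add: D_1)
next
  case (Suc m)
  have "poly_cutoff (Suc (Suc m)) f = poly_cutoff (Suc m) f + monom (coeff f (Suc m)) (Suc m)"
    by (auto simp: poly_eq_iff coeff_poly_cutoff)
  then have "poly (poly_cutoff (Suc (Suc m)) f) \<xi> = 2 * \<xi> ^ m * D (Suc m) f \<xi> + coeff f (Suc m) * \<xi> ^ Suc m"
    using Suc by (simp add: poly_monom)
  also have "\<dots> = 2 * \<xi> ^ Suc m * D (Suc (Suc m)) f \<xi>"
    using assms by (simp add: D_Suc[of \<xi> "Suc m"] field_simps)
  finally show ?case by simp
qed

lemma D_degree:
  assumes "\<xi> \<noteq> 0" "degree f \<le> n"
  shows "D (Suc n) f \<xi> = poly f \<xi> / (2 * \<xi> ^ n)"
proof -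
  have "poly_cutoff (Suc n) f = f"
    using assms(2) by (auto simp: poly_eq_iff coeff_poly_cutoff coeff_eq_0)
  then show ?thesis using D_eq_poly_cutoff[OF assms(1), of n f] assms(1) by (simp add: field_simps)
qed

lemma D_add: "D k (f + g) \<xi> = D k f \<xi> + D k g \<xi>"
  by (simp add: D_def sum.distrib distrib_right distrib_left)

lemma D_diff: "D k (f - g) \<xi> = D k f \<xi> - D k g \<xi>"
  by (simp add: D_def sum_subtractf left_diff_distrib right_diff_distrib)

text \<open>The flow equations contain negative powers and are given at nonzero arguments only;
  multiplying both sides by the indeterminate removes the exception at \<open>0\<close>.\<close>

lemma poly_eqI_nonzero:
  fixes p q :: "complex poly"
  assumes "\<And>z. z \<noteq> 0 \<Longrightarrow> poly p z = poly q z"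
  shows "p = q"
proof -
  have "poly (p * [:0, 1:]) z = poly (q * [:0, 1:]) z" for z
    using assms[of z] by (cases "z = 0") auto
  then have "p * [:0, 1:] = q * [:0, 1:]" using poly_eq_poly_eq_iff by blast
  then show ?thesis by simp
qed

section \<open>Truncated polynomials and the compatibility of the flows\<close>

lemma poly_cutoff_diff: "poly_cutoff n (p - q) = poly_cutoff n p - poly_cutoff n (q :: 'a::ab_group_add poly)"
  by (simp add: poly_eq_iff coeff_poly_cutoff)

lemma monom_dvd_cutoff_diff: "monom 1 k dvd poly_cutoff k p - (p :: 'a::idom poly)"
  by (simp add: monom_1_dvd_iff' coeff_poly_cutoff)

lemma degree_poly_cutoff_Suc: "degree (poly_cutoff (Suc m) p) \<le> m"
  by (rule degree_le) (simp add: coeff_poly_cutoff)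

text \<open>Both \<open>a - poly_cutoff k a\<close> and its analogue for \<open>i\<close> and \<open>b\<close> vanish to the order of the cutoff,
  so their antisymmetrised product does not contribute below degree \<open>i + k\<close>.\<close>

lemma poly_cutoff_exchange:
  fixes a b :: "'a::idom poly"
  defines "ca \<equiv> \<lambda>m. poly_cutoff (Suc m) a" and "cb \<equiv> \<lambda>m. poly_cutoff (Suc m) b"
  shows "poly_cutoff (Suc (p + q)) ((ca q * b - cb q * a) - (ca p * b - cb p * a)) = ca q * cb p - ca p * cb q"
proof -
  \<comment> \<open>The products \<open>a * b\<close> cancel in \<open>X\<close>, which is therefore
    the gap between the two sides before truncation. The cutoff annihilates \<open>X\<close> and
    leaves the right-hand side intact, whose degree is at most \<open>p + q\<close>.\<close>
  define X where "X = (ca q - a) * (cb p - b) - (ca p - a) * (cb q - b)"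
  have "monom 1 (Suc q) * monom 1 (Suc p) dvd (ca q - a) * (cb p - b)"
    unfolding ca_def cb_def by (intro mult_dvd_mono monom_dvd_cutoff_diff)
  moreover have "monom 1 (Suc q) * monom 1 (Suc p) dvd (ca p - a) * (cb q - b)"
    unfolding ca_def cb_def mult.commute[of "monom 1 (Suc q)"] by (intro mult_dvd_mono monom_dvd_cutoff_diff)
  ultimately have "monom 1 (Suc q) * monom 1 (Suc p) dvd X" unfolding X_def by (rule dvd_diff)
  then have "monom 1 (Suc q + Suc p) dvd X" by (simp add: mult_monom)
  then have X: "coeff X j = 0" if "j < Suc (p + q)" for j
    using that by (simp add: monom_1_dvd_iff')
  have "degree (ca q * cb p - ca p * cb q) \<le> p + q"
  proof (rule degree_diff_le)
    show "degree (ca q * cb p) \<le> p + q"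
      using degree_mult_le[of "ca q" "cb p"] degree_poly_cutoff_Suc[of q a] degree_poly_cutoff_Suc[of p b]
      unfolding ca_def cb_def by linarith
    show "degree (ca p * cb q) \<le> p + q"
      using degree_mult_le[of "ca p" "cb q"] degree_poly_cutoff_Suc[of p a] degree_poly_cutoff_Suc[of q b]
      unfolding ca_def cb_def by linarith
  qed
  then have deg: "coeff (ca q * cb p - ca p * cb q) j = 0" if "\<not> j < Suc (p + q)" for j
    using that by (intro coeff_eq_0) simp
  have "(ca q * b - cb q * a) - (ca p * b - cb p * a) = (ca q * cb p - ca p * cb q) - X"
    by (simp add: X_def algebra_simps)
  then show ?thesis
    using X deg by (simp add: poly_eq_iff coeff_poly_cutoff)
qed

text \<open>The \<open>k\<close>-th flow equation at a frozen time: \<open>Y\<close>,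
  \<open>V\<close> and \<open>W\<close> stand for 2 - u, u' and \<partial>_k u as
  polynomials.\<close>

definition flow_eq :: "nat \<Rightarrow> complex poly \<Rightarrow> complex poly \<Rightarrow> complex poly \<Rightarrow> bool" where
  "flow_eq k Y V W \<longleftrightarrow> (\<forall>\<zeta>. \<zeta> \<noteq> 0 \<longrightarrow> poly W \<zeta> = D k Y \<zeta> * poly V \<zeta> - D k V \<zeta> * poly Y \<zeta>)"

lemma flow_eq_cutoff:
  assumes "flow_eq (Suc m) Y V W"
  shows "monom 2 m * W = poly_cutoff (Suc m) Y * V - poly_cutoff (Suc m) V * Y"
proof (rule poly_eqI_nonzero)
  fix z :: complex assume z: "z \<noteq> 0"
  then have W: "poly W z = D (Suc m) Y z * poly V z - D (Suc m) V z * poly Y z"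
    using assms unfolding flow_eq_def by blast
  show "poly (monom 2 m * W) z = poly (poly_cutoff (Suc m) Y * V - poly_cutoff (Suc m) V * Y) z"
    unfolding poly_mult poly_diff poly_monom W D_eq_poly_cutoff[OF z, symmetric] by (simp add: algebra_simps)
qed

text \<open>In degree \<open>m + 1\<close> of the cleared flow equation each truncated product lacks
  a single term. The full products cancel, one missing term contains \<open>coeff V 0 = 0\<close>,
  and the other is \<open>coeff Y 0 * coeff V (Suc m)\<close>. In \<open>pd_u1\<close> this becomes
  \<partial>_k u_1 = \<partial>_x u_k.\<close>

lemma flow_eq_coeff_1:
  assumes "flow_eq (Suc m) Y V W" "coeff Y 0 = 2" "coeff V 0 = 0"
  shows "coeff W 1 = coeff V (Suc m)"
proof -
  have cut: "coeff (poly_cutoff (Suc m) a * b) (Suc m) = coeff (a * b) (Suc m) - coeff a (Suc m) * coeff b 0" for a b :: "complex poly"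
    by (simp add: coeff_mult coeff_poly_cutoff)
  have "coeff (monom 2 m * W) (Suc m) = 2 * coeff W 1"
    by (simp add: coeff_monom_mult)
  moreover have "coeff (monom 2 m * W) (Suc m) = 2 * coeff V (Suc m)"
    using assms(2,3) by (simp add: flow_eq_cutoff[OF assms(1)] cut mult.commute[of V])
  ultimately show ?thesis by simp
qed

text \<open>Both cleared flow equations are truncated at the common degree \<open>p + q\<close>;
  \<open>poly_cutoff_exchange\<close> then reduces their difference to products of truncations,
  which are values of \<open>D\<close> again.\<close>

lemma flow_eq_commutator:
  assumes \<xi>: "\<xi> \<noteq> 0" and i: "flow_eq i Y V Wi" "i \<ge> 1" and k: "flow_eq k Y V Wk" "k \<ge> 1"
  shows "D i Wk \<xi> - D k Wi \<xi> = D k Y \<xi> * D i V \<xi> - D i Y \<xi> * D k V \<xi>"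
proof -
  obtain p q where pq: "i = Suc p" "k = Suc q" using i(2) k(2) by (metis Suc_le_D One_nat_def)
  \<comment> \<open>Multiplication by \<open>monom 2 q\<close> raises the cutoff by
    \<open>q\<close>, which brings both terms to the common cutoff.\<close>
  have shift: "monom 2 q * poly_cutoff (Suc p) W = poly_cutoff (Suc (p + q)) (monom 2 q * W)" for p q and W :: "complex poly"
    by (auto simp: poly_eq_iff coeff_poly_cutoff coeff_monom_mult)
  have "monom 2 q * poly_cutoff (Suc p) Wk - monom 2 p * poly_cutoff (Suc q) Wi
      = poly_cutoff (Suc q) Y * poly_cutoff (Suc p) V - poly_cutoff (Suc p) Y * poly_cutoff (Suc q) V"
    using poly_cutoff_exchange[of p q Y V] flow_eq_cutoff[OF i(1)[unfolded pq]] flow_eq_cutoff[OF k(1)[unfolded pq]]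
    by (simp add: shift poly_cutoff_diff add.commute[of q p])
  from arg_cong[OF this, of "\<lambda>f. poly f \<xi>"]
  have "(2 * \<xi> ^ q) * (2 * \<xi> ^ p * D i Wk \<xi>) - (2 * \<xi> ^ p) * (2 * \<xi> ^ q * D k Wi \<xi>)
      = (2 * \<xi> ^ q * D k Y \<xi>) * (2 * \<xi> ^ p * D i V \<xi>) - (2 * \<xi> ^ p * D i Y \<xi>) * (2 * \<xi> ^ q * D k V \<xi>)"
    unfolding pq by (simp only: D_eq_poly_cutoff[OF \<xi>] poly_diff poly_mult poly_monom)
  then have "(4 * \<xi> ^ p * \<xi> ^ q) * (D i Wk \<xi> - D k Wi \<xi>)
      = (4 * \<xi> ^ p * \<xi> ^ q) * (D k Y \<xi> * D i V \<xi> - D i Y \<xi> * D k V \<xi>)"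
    by (simp add: algebra_simps)
  then show ?thesis using \<xi> by simp
qed

text \<open>This is \<open>D (Suc m)\<close> applied to the stationary equation. Truncation does not
  commute with the factor \<open>inverse \<zeta>\<close>: the shift of the coefficients of
  \<open>V\<close> carries one of them across the cut, and that one is the right-hand side.\<close>

lemma stationary_D:
  assumes stat: "\<And>\<zeta>. \<zeta> \<noteq> 0 \<Longrightarrow> poly Z \<zeta> + 2 * c * poly Y \<zeta> - 4 * (inverse \<zeta> + w) * poly V \<zeta> = 0"
    and coeffs: "coeff Y 0 = 2" "coeff V 0 = 0" "coeff Z 0 = 0" "coeff V 1 = c"
    and "\<xi> \<noteq> 0"
  shows "c * D (Suc m) Y \<xi> - 2 * (inverse \<xi> + w) * D (Suc m) V \<xi> + D (Suc m) Z \<xi> / 2 = coeff V (Suc m)"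
proof -
  have "[:0, 1:] * (Z + smult (2 * c) Y) - smult 4 ([:1, w:] * V) = 0"
  proof (rule poly_eqI_nonzero)
    fix z :: complex assume "z \<noteq> 0"
    then show "poly ([:0, 1:] * (Z + smult (2 * c) Y) - smult 4 ([:1, w:] * V)) z = poly 0 z"
      using stat[of z] by (simp add: field_simps)
  qed
  then have "coeff ([:0, 1:] * (Z + smult (2 * c) Y) - smult 4 ([:1, w:] * V)) (Suc j) = 0" for j by simp
  then have rec: "coeff Z j + 2 * c * coeff Y j - 4 * (coeff V (Suc j) + w * coeff V j) = 0" for j by simp
  show ?thesis
  proof (induction m)
    case 0
    then show ?case using coeffs by (simp add: D_1)
  next
    case (Suc m)
    have "c * D (Suc (Suc m)) Y \<xi> - 2 * (inverse \<xi> + w) * D (Suc (Suc m)) V \<xi> + D (Suc (Suc m)) Z \<xi> / 2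
      = (c * D (Suc m) Y \<xi> - 2 * (inverse \<xi> + w) * D (Suc m) V \<xi> + D (Suc m) Z \<xi> / 2) / \<xi>
        + (c * coeff Y (Suc m) - 2 * (inverse \<xi> + w) * coeff V (Suc m) + coeff Z (Suc m) / 2) / 2"
      unfolding D_Suc[OF \<open>\<xi> \<noteq> 0\<close>, of "Suc m"] by (simp add: algebra_simps add_divide_distrib diff_divide_distrib)
    \<comment> \<open>The induction hypothesis contributes \<open>coeff V (Suc m) / \<xi>\<close>,
      which cancels the \<open>inverse \<xi>\<close> part of the new term.\<close>
    also have "\<dots> = (coeff Z (Suc m) + 2 * c * coeff Y (Suc m) - 4 * w * coeff V (Suc m)) / 4"
      unfolding Suc using \<open>\<xi> \<noteq> 0\<close> by (simp add: field_simps)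
    also have "\<dots> = coeff V (Suc (Suc m))" using rec[of "Suc m"] by (simp add: algebra_simps)
    finally show ?case .
  qed
qed

section \<open>The flow at a fixed \<open>\<xi>\<close>\<close>

lemma coeff_genpoly: "coeff (genpoly g a) j = (if j \<in> {1..g} then a j else 0)"
  by (simp add: genpoly_def coeff_sum coeff_monom)

lemma coeff_2: "coeff (2 :: complex poly) j = (if j = 0 then 2 else 0)"
  by (cases j) (simp_all add: numeral_poly)

lemma degree_genpoly: "degree (genpoly g a) \<le> g"
  by (rule degree_le) (simp add: coeff_genpoly)

lemma poly_genpoly: "poly (genpoly g a) \<xi> = (\<Sum>j=1..g. a j * \<xi> ^ j)"
  by (simp add: genpoly_def poly_sum poly_monom)

lemma D_genpoly: "D k (genpoly g a) \<xi> = (\<Sum>j=1..g. a j * D k (monom 1 j) \<xi>)"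
proof -
  have "D k (\<Sum>j\<in>S. monom (a j) j) \<xi> = (\<Sum>j\<in>S. a j * D k (monom 1 j) \<xi>)" if "finite S" for S
    using that
  proof (induction S rule: finite_induct)
    case empty
    then show ?case by (simp add: D_def)
  next
    case (insert x S)
    have "D k (monom (a x) x) \<xi> = a x * D k (monom 1 x) \<xi>"
      by (simp add: D_def sum_distrib_left if_distrib[of "\<lambda>z. z * _"] if_distrib[of "\<lambda>z. _ * z"] cong: if_cong)
    with insert show ?case by (simp add: D_add)
  qed
  then show ?thesis by (simp add: genpoly_def)
qed

lemma (in time_domain) kderiv_linear:
  "kderiv e (\<lambda>t::'k^'g. \<Sum>i=1..CARD('g). c i * cplx (t $ e i)) c t"
proof -
  have "bounded_linear (\<lambda>t::'k^'g. cplx (t $ e i))" for i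
    by (rule bounded_linear_compose[OF bounded_linear_cplx bounded_linear_vec_nth])
  then have "bounded_linear (\<lambda>t::'k^'g. \<Sum>i=1..CARD('g). c i * cplx (t $ e i))"
    by (intro bounded_linear_sum bounded_linear_const_mult)
  then show ?thesis unfolding kderiv_def by (rule bounded_linear_imp_has_derivative)
qed

locale kdv_flow = time_domain e T
  for e :: "nat \<Rightarrow> 'g::finite" and T :: "('k::time_scalar ^ 'g) set" +
  fixes u :: "nat \<Rightarrow> 'k ^ 'g \<Rightarrow> complex" and \<xi> :: complex
  assumes u_smooth: "\<And>i. i \<in> {1..CARD('g)} \<Longrightarrow> smooth e T (u i)"
    and stationary: "\<And>t \<zeta>. t \<in> T \<Longrightarrow> \<zeta> \<noteq> 0 \<Longrightarrow>
          poly (U0 (\<lambda>i. pd e 1 (pd e 1 (pd e 1 (u i)))) t) \<zeta>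
          + 2 * pd e 1 (u 1) t * (2 - poly (U0 u t) \<zeta>)
          - 4 * (inverse \<zeta> + u 1 t) * poly (dU e 1 u t) \<zeta> = 0"
    and flow: "\<And>k t \<zeta>. k \<in> {1..CARD('g)} \<Longrightarrow> t \<in> T \<Longrightarrow> \<zeta> \<noteq> 0 \<Longrightarrow>
          poly (dU e k u t) \<zeta>
          = D k (2 - U0 u t) \<zeta> * poly (dU e 1 u t) \<zeta>
            - D k (dU e 1 u t) \<zeta> * (2 - poly (U0 u t) \<zeta>)"
    and xi: "\<xi> \<noteq> 0"
    and nonzero: "\<And>t. t \<in> T \<Longrightarrow> 2 - poly (U0 u t) \<xi> \<noteq> 0"
begin

definition y :: "'k ^ 'g \<Rightarrow> complex" where "y t = 2 - poly (U0 u t) \<xi>"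

definition A :: "nat \<Rightarrow> 'k ^ 'g \<Rightarrow> complex" where "A k t = D k (2 - U0 u t) \<xi>"

abbreviation q :: "'k ^ 'g \<Rightarrow> complex" where "q t \<equiv> inverse \<xi> + u 1 t"

abbreviation dx :: "('k ^ 'g \<Rightarrow> complex) \<Rightarrow> 'k ^ 'g \<Rightarrow> complex" where "dx \<equiv> pd e 1"

text \<open>Both \<open>y\<close> and every \<open>A k\<close> are a constant minus a fixed linear
  combination of the \<open>u j\<close>, so their derivatives are computed once in this form. The
  constant drops out under differentiation, hence the \<open>0\<close> in
  \<open>pd_affine\<close>.\<close>

definition affine :: "complex \<Rightarrow> (nat \<Rightarrow> complex) \<Rightarrow> (nat \<Rightarrow> 'k ^ 'g \<Rightarrow> complex) \<Rightarrow> 'k ^ 'g \<Rightarrow> complex" where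
  "affine \<kappa> c v t = \<kappa> - (\<Sum>j=1..CARD('g). v j t * c j)"

lemma one_in: "1 \<in> {1..CARD('g)}" "Suc 0 \<in> {1..CARD('g)}"
  by (auto simp: Suc_le_eq)

lemma smooth_affine: "(\<And>i. i \<in> {1..CARD('g)} \<Longrightarrow> smooth e T (v i)) \<Longrightarrow> smooth e T (affine \<kappa> c v)"
  unfolding affine_def[abs_def] by (intro smooth_diff smooth_const smooth_sum smooth_mult) auto

lemma pd_affine:
  assumes "\<And>i. i \<in> {1..CARD('g)} \<Longrightarrow> smooth e T (v i)" "t \<in> T" "l \<in> {1..CARD('g)}"
  shows "pd e l (affine \<kappa> c v) t = affine 0 c (\<lambda>j. pd e l (v j)) t"
proof -
  have "pd e l (\<lambda>t. \<Sum>j=1..CARD('g). v j t * c j) t = (\<Sum>j=1..CARD('g). pd e l (\<lambda>t. v j t * c j) t)"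
    using assms by (intro pd_sum smooth_mult smooth_const) auto
  also have "\<dots> = (\<Sum>j=1..CARD('g). pd e l (v j) t * c j)"
    using assms by (intro sum.cong refl) (simp add: pd_mult smooth_const pd_const)
  finally show ?thesis
    unfolding affine_def[abs_def]
    using assms by (subst pd_diff) (auto intro!: smooth_const smooth_sum smooth_mult simp: pd_const)
qed

lemma pd_affine_u:
  "t \<in> T \<Longrightarrow> l \<in> {1..CARD('g)} \<Longrightarrow> pd e l (affine \<kappa> c u) t = affine 0 c (\<lambda>j. pd e l (u j)) t"
  by (intro pd_affine u_smooth)

lemma pd_cong: "smooth e T f \<Longrightarrow> (\<And>s. s \<in> T \<Longrightarrow> g s = f s) \<Longrightarrow> t \<in> T \<Longrightarrow> k \<in> {1..CARD('g)} \<Longrightarrow> pd e k g t = pd e k f t"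
  by (rule pd_cong_on) auto

lemma dx2_affine:
  assumes "t \<in> T"
  shows "dx (dx (affine \<kappa> c u)) t = affine 0 c (\<lambda>j. dx (dx (u j))) t"
proof -
  have "dx (dx (affine \<kappa> c u)) t = dx (affine 0 c (\<lambda>j. dx (u j))) t"
    using assms one_in by (intro pd_cong smooth_affine smooth_pd pd_affine u_smooth)
  also have "\<dots> = affine 0 c (\<lambda>j. dx (dx (u j))) t"
    using assms one_in by (intro pd_affine smooth_pd u_smooth)
  finally show ?thesis .
qed

lemma dx3_affine:
  assumes "t \<in> T"
  shows "dx (dx (dx (affine \<kappa> c u))) t = affine 0 c (\<lambda>j. dx (dx (dx (u j)))) t"
proof -
  have "dx (dx (dx (affine \<kappa> c u))) t = dx (affine 0 c (\<lambda>j. dx (dx (u j)))) t"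
    using assms one_in by (intro pd_cong smooth_affine smooth_pd dx2_affine u_smooth)
  also have "\<dots> = affine 0 c (\<lambda>j. dx (dx (dx (u j)))) t"
    using assms one_in by (intro pd_affine smooth_pd u_smooth)
  finally show ?thesis .
qed

lemma y_affine: "y = affine 2 (\<lambda>j. \<xi> ^ j) u"
  by (rule ext) (simp add: y_def affine_def U0_def poly_genpoly)

lemma A_affine: "A k = affine (D k 2 \<xi>) (\<lambda>j. D k (monom 1 j) \<xi>) u"
  by (rule ext) (simp add: A_def affine_def U0_def D_genpoly D_diff)

lemma poly_U0_affine: "poly (U0 v t) \<xi> = - affine 0 (\<lambda>j. \<xi> ^ j) v t"
  by (simp add: affine_def U0_def poly_genpoly)

lemma D_U0_affine: "D k (U0 v t) \<xi> = - affine 0 (\<lambda>j. D k (monom 1 j) \<xi>) v t"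
  by (simp add: affine_def U0_def D_genpoly)

lemma smooth_y: "smooth e T y"
  unfolding y_affine by (intro smooth_affine u_smooth)

lemma smooth_A: "smooth e T (A k)"
  unfolding A_affine by (intro smooth_affine u_smooth)

lemma flow_eq_u: "k \<in> {1..CARD('g)} \<Longrightarrow> t \<in> T \<Longrightarrow> flow_eq k (2 - U0 u t) (dU e 1 u t) (dU e k u t)"
  unfolding flow_eq_def poly_diff poly_numeral using flow by blast

lemma pd_y_dU: "t \<in> T \<Longrightarrow> l \<in> {1..CARD('g)} \<Longrightarrow> pd e l y t = - poly (dU e l u t) \<xi>"
  unfolding y_affine dU_def poly_U0_affine minus_minus by (rule pd_affine_u)

lemma pd_A_dU: "t \<in> T \<Longrightarrow> l \<in> {1..CARD('g)} \<Longrightarrow> pd e l (A k) t = - D k (dU e l u t) \<xi>"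
  unfolding A_affine dU_def D_U0_affine minus_minus by (rule pd_affine_u)

lemma pd_y:
  assumes "t \<in> T" "k \<in> {1..CARD('g)}"
  shows "pd e k y t = A k t * dx y t - dx (A k) t * y t"
  using flow[OF assms(2,1) xi] unfolding pd_y_dU[OF assms] pd_y_dU[OF assms(1) one_in(1)] pd_A_dU[OF assms(1) one_in(1)]
  by (simp add: A_def y_def)

lemma dx3_y:
  assumes t: "t \<in> T"
  shows "dx (dx (dx y)) t = 2 * dx (u 1) t * y t + 4 * q t * dx y t"
  using stationary[OF t xi] unfolding poly_U0_affine dU_def y_affine dx3_affine[OF t] pd_affine_u[OF t one_in(1)]
  by (simp add: affine_def algebra_simps)

lemma coeff_dU: "coeff (dU e k u t) j = (if j \<in> {1..CARD('g)} then pd e k (u j) t else 0)"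
  by (simp add: dU_def U0_def coeff_genpoly)

lemma coeff_U0:
  fixes v :: "nat \<Rightarrow> 'k ^ 'g \<Rightarrow> complex"
  shows "coeff (U0 v t) j = (if j \<in> {1..CARD('g)} then v j t else 0)"
  by (simp add: U0_def coeff_genpoly)

lemma pd_u1: "t \<in> T \<Longrightarrow> k \<in> {1..CARD('g)} \<Longrightarrow> pd e k (u 1) t = dx (u k) t"
  using flow_eq_coeff_1[of "k - 1" "2 - U0 u t" "dU e 1 u t" "dU e k u t"] flow_eq_u[of k t] one_in
  by (simp add: coeff_dU coeff_U0 coeff_2)

text \<open>The truncated stationary equation with 2 - u, u' and u''' for \<open>Y\<close>,
  \<open>V\<close> and \<open>Z\<close>. It trades \<open>dx (u k)\<close> for derivatives of
  \<open>A k\<close>, both in the eigenvalue equations and in the derivative of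
  \<open>mu\<close>.\<close>

lemma dx_u:
  assumes t: "t \<in> T" and k: "k \<in> {1..CARD('g)}"
  shows "dx (u k) t = A k t * dx (u 1) t + 2 * q t * dx (A k) t - dx (dx (dx (A k))) t / 2"
proof -
  obtain m where m: "k = Suc m" using k by (cases k) auto
  define Z where "Z = U0 (\<lambda>i. dx (dx (dx (u i)))) t"
  have "dx (u 1) t * D (Suc m) (2 - U0 u t) \<xi> - 2 * q t * D (Suc m) (dU e 1 u t) \<xi> + D (Suc m) Z \<xi> / 2
      = coeff (dU e 1 u t) (Suc m)"
  proof (rule stationary_D[OF _ _ _ _ _ xi])
    show "poly Z \<zeta> + 2 * dx (u 1) t * poly (2 - U0 u t) \<zeta> - 4 * (inverse \<zeta> + u 1 t) * poly (dU e 1 u t) \<zeta> = 0"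
      if "\<zeta> \<noteq> 0" for \<zeta>
      using stationary[OF t that] by (simp add: Z_def)
  qed (use one_in in \<open>auto simp: coeff_dU coeff_U0 coeff_2 Z_def U0_def coeff_genpoly\<close>)
  moreover have "D k Z \<xi> = - dx (dx (dx (A k))) t"
    unfolding Z_def D_U0_affine A_affine dx3_affine[OF t] ..
  ultimately show ?thesis
    using k unfolding m[symmetric] pd_A_dU[OF t one_in(1)] by (simp add: A_def coeff_dU ac_simps)
qed

lemma pd_A_commutator:
  assumes t: "t \<in> T" and i: "i \<in> {1..CARD('g)}" and k: "k \<in> {1..CARD('g)}"
  shows "pd e k (A i) t - pd e i (A k) t = A k t * dx (A i) t - A i t * dx (A k) t"
  using flow_eq_commutator[OF xi flow_eq_u[OF i t] _ flow_eq_u[OF k t]] i k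
  unfolding pd_A_dU[OF t i] pd_A_dU[OF t k] pd_A_dU[OF t one_in(1)] A_def by (simp add: algebra_simps)

lemma A_1: "A (Suc 0) t = 1"
  by (simp add: A_def D_1 coeff_U0 coeff_2)

lemma A_Suc: "k \<in> {1..CARD('g)} \<Longrightarrow> A (Suc k) t = A k t / \<xi> - u k t / 2"
  by (simp add: A_def D_Suc[OF xi] coeff_U0 coeff_2)

lemma A_last: "A (Suc CARD('g)) t = y t / (2 * \<xi> ^ CARD('g))"
proof -
  have "degree (2 - U0 u t) \<le> CARD('g)"
    by (rule degree_le) (simp add: coeff_U0 coeff_2)
  then show ?thesis by (simp add: A_def D_degree[OF xi] y_def)
qed

lemma y_nonzero: "t \<in> T \<Longrightarrow> y t \<noteq> 0"
  using nonzero by (simp add: y_def)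

lemma closed_A_over_y:
  assumes t: "t \<in> T" and i: "i \<in> {1..CARD('g)}" and k: "k \<in> {1..CARD('g)}"
  shows "pd e k (\<lambda>t. A i t / y t) t = pd e i (\<lambda>t. A k t / y t) t"
proof -
  \<comment> \<open>In the difference of the quotient-rule numerators the terms with
    \<open>dx y\<close> cancel, and \<open>y t\<close> times the commutator relation
    remains.\<close>
  have "pd e k (A i) t * y t - A i t * pd e k y t - (pd e i (A k) t * y t - A k t * pd e i y t)
    = y t * (pd e k (A i) t - pd e i (A k) t) - y t * (A k t * dx (A i) t - A i t * dx (A k) t)"
    unfolding pd_y[OF t i] pd_y[OF t k] by (simp add: algebra_simps)
  also have "\<dots> = 0" by (simp add: pd_A_commutator[OF t i k])
  finally show ?thesis
    using pd_divide[OF t k smooth_A smooth_y y_nonzero, of i] pd_divide[OF t i smooth_A smooth_y y_nonzero, of k]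
    by simp
qed

section \<open>Constancy of \<open>mu\<close> at the fixed \<open>\<xi>\<close>\<close>

lemma mu_eq:
  assumes t: "t \<in> T"
  shows "mu e u t \<xi> = ((dx y t)\<^sup>2 - 2 * dx (dx y) t * y t + 4 * q t * (y t)\<^sup>2) / 4"
  unfolding mu_def poly_U0_affine dU_def y_affine dx2_affine[OF t] pd_affine_u[OF t one_in(1)]
  by (simp add: affine_def)

lemmas smooth_intros = smooth_add smooth_diff smooth_mult smooth_const smooth_pd smooth_y smooth_A u_smooth one_in

lemma pd_dx_y:
  assumes t: "t \<in> T" and k: "k \<in> {1..CARD('g)}"
  shows "pd e k (dx y) t = A k t * dx (dx y) t - dx (dx (A k)) t * y t"
proof -
  have "pd e k (dx y) t = dx (pd e k y) t"
    by (rule pd_commute[OF t k smooth_y one_in(1)])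
  also have "\<dots> = dx (\<lambda>t. A k t * dx y t - dx (A k) t * y t) t"
    using t k by (intro pd_cong pd_y smooth_intros)
  also have "\<dots> = A k t * dx (dx y) t - dx (dx (A k)) t * y t"
    using t by (simp add: pd_diff pd_mult smooth_intros)
  finally show ?thesis .
qed

lemma pd_dx2_y:
  assumes t: "t \<in> T" and k: "k \<in> {1..CARD('g)}"
  shows "pd e k (dx (dx y)) t = dx (A k) t * dx (dx y) t + A k t * dx (dx (dx y)) t
    - dx (dx (dx (A k))) t * y t - dx (dx (A k)) t * dx y t"
proof -
  have "pd e k (dx (dx y)) t = dx (pd e k (dx y)) t"
    by (rule pd_commute[OF t k _ one_in(1)]) (intro smooth_intros)
  also have "\<dots> = dx (\<lambda>t. A k t * dx (dx y) t - dx (dx (A k)) t * y t) t"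
    using t k by (intro pd_cong pd_dx_y smooth_intros)
  also have "\<dots> = dx (A k) t * dx (dx y) t + A k t * dx (dx (dx y)) t
    - dx (dx (dx (A k))) t * y t - dx (dx (A k)) t * dx y t"
    using t by (simp add: pd_diff pd_mult smooth_intros)
  finally show ?thesis .
qed

text \<open>Carries the condition on \<open>\<alpha>\<close> from a single point to all of
  \<open>T\<close>. The derivative of \<open>4 * mu\<close> along each flow is a multiple of the
  stationary equation \<open>dx3_y\<close>.\<close>

lemma mu_constant:
  assumes "connected T" "s \<in> T" "t \<in> T"
  shows "mu e u s \<xi> = mu e u t \<xi>"
proof -
  define f where "f = (\<lambda>t. dx y t * dx y t - 2 * (dx (dx y) t * y t) + 4 * (q t * (y t * y t)))"
  have sf: "smooth e T f"
    unfolding f_def by (intro smooth_intros)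
  have pd0: "pd e k f t = 0" if t: "t \<in> T" and k: "k \<in> {1..CARD('g)}" for t k
  proof -
    have "pd e k f t = 2 * dx y t * pd e k (dx y) t - 2 * pd e k (dx (dx y)) t * y t - 2 * dx (dx y) t * pd e k y t
        + 4 * pd e k (u 1) t * (y t)\<^sup>2 + 8 * q t * y t * pd e k y t"
      unfolding f_def using t k
      by (simp add: pd_diff pd_mult pd_add pd_const smooth_intros power2_eq_square algebra_simps)
    also have "\<dots> = 2 * y t * A k t * (2 * dx (u 1) t * y t + 4 * q t * dx y t - dx (dx (dx y)) t)"
      unfolding pd_u1[OF t k] dx_u[OF t k] pd_dx_y[OF t k] pd_dx2_y[OF t k] pd_y[OF t k]
      by (simp add: power2_eq_square algebra_simps)
    also have "\<dots> = 0" unfolding dx3_y[OF t] by simp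
    finally show ?thesis .
  qed
  have "kderiv e f (\<lambda>i. 0) t" if t: "t \<in> T" for t
  proof -
    have "(\<Sum>i=1..CARD('g). pd e i f t * cplx (v $ e i)) = (\<Sum>i=1..CARD('g). 0 * cplx (v $ e i))" for v :: "'k^'g"
      by (intro sum.cong refl) (simp add: pd0[OF t])
    then show ?thesis using smooth_kderiv[OF sf t] unfolding kderiv_def by simp
  qed
  then have f_const: "f s = f t" using assms by (intro kderiv_zero_constant)
  have m: "mu e u t \<xi> = f t / 4" if "t \<in> T" for t
    unfolding mu_eq[OF that] by (simp add: f_def power2_eq_square mult.assoc)
  show ?thesis by (simp only: m[OF assms(2)] m[OF assms(3)] f_const)
qed

end

section \<open>Common eigenfunctions\<close>

context kdv_flow
begin

context
  fixes \<alpha> :: "nat \<Rightarrow> complex"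
begin

lemmas pd_rules = pd_diff pd_mult pd_add pd_const smooth_intros

definition alpha_xi :: complex where "alpha_xi = poly (genpoly CARD('g) \<alpha>) \<xi>"

definition alpha_D :: "nat \<Rightarrow> complex" where "alpha_D i = D i (genpoly CARD('g) \<alpha>) \<xi>"

lemma alpha_D_1: "alpha_D (Suc 0) = 0"
  by (simp add: alpha_D_def D_1 coeff_genpoly)

lemma alpha_D_Suc: "i \<in> {1..CARD('g)} \<Longrightarrow> alpha_D (Suc i) = alpha_D i / \<xi> + \<alpha> i / 2"
  by (simp add: alpha_D_def D_Suc[OF xi] coeff_genpoly)

lemma alpha_D_last: "alpha_D (Suc CARD('g)) = alpha_xi / (2 * \<xi> ^ CARD('g))"
  by (simp add: alpha_D_def alpha_xi_def D_degree[OF xi degree_genpoly])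

definition W :: "nat \<Rightarrow> ('k ^ 'g \<Rightarrow> complex) \<Rightarrow> 'k ^ 'g \<Rightarrow> complex" where
  "W i \<phi> t = A i t * dx \<phi> t - 1/2 * (dx (A i) t * \<phi> t) - 2 * alpha_D i * \<phi> t"

text \<open>\<open>pd_u1\<close> turns the derivative of \<open>u 1\<close> in direction
  \<open>i\<close> into \<open>dx (u i)\<close>; the weights 1/2 and 1/4 then merge into
  3/4.\<close>

lemma Uop_eq:
  assumes \<phi>: "smooth e T \<phi>" and t: "t \<in> T" and i: "i \<in> {1..CARD('g)}"
  shows "Uop e u i \<phi> t = dx (dx (pd e i \<phi>)) t - u 1 t * pd e i \<phi> t - 3/4 * dx (u i) t * \<phi> t
    - 1/2 * u i t * dx \<phi> t - pd e (Suc i) \<phi> t"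
proof -
  have 1: "pd e i (\<lambda>s. u 1 s * \<phi> s) t = dx (u i) t * \<phi> t + u 1 t * pd e i \<phi> t"
    using pd_mult[OF t i u_smooth[OF one_in(1)] \<phi>] pd_u1[OF t i] by simp
  have 2: "dx (\<lambda>s. u i s * \<phi> s) t = dx (u i) t * \<phi> t + u i t * dx \<phi> t"
    using pd_mult[OF t one_in(1) u_smooth[OF i] \<phi>] .
  show ?thesis unfolding Uop_def 1 2 by (simp add: field_simps)
qed

text \<open>The Schroedinger equation and its derivative eliminate the second and third derivatives
  of \<open>\<phi>\<close>. The weight 1/2 in \<open>W\<close> makes the terms
  \<open>dx (dx (A i)) t * dx \<phi> t\<close> cancel.\<close>

lemma dx2_W:
  assumes \<phi>: "smooth e T \<phi>" and L: "\<And>t. t \<in> T \<Longrightarrow> dx (dx \<phi>) t = q t * \<phi> t" and t: "t \<in> T"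
  shows "dx (dx (W i \<phi>)) t = 3/2 * dx (A i) t * q t * \<phi> t + A i t * (dx (u 1) t * \<phi> t + q t * dx \<phi> t)
    - 1/2 * dx (dx (dx (A i))) t * \<phi> t - 2 * alpha_D i * q t * \<phi> t"
proof -
  have W1: "dx (W i \<phi>) s = 1/2 * (dx (A i) s * dx \<phi> s) + A i s * dx (dx \<phi>) s
      - 1/2 * (dx (dx (A i)) s * \<phi> s) - 2 * alpha_D i * dx \<phi> s" if s: "s \<in> T" for s
    unfolding W_def[abs_def] by (simp only: pd_rules \<phi> s) (simp add: algebra_simps)
  have "dx (dx (dx \<phi>)) t = dx (\<lambda>t. q t * \<phi> t) t"
    using t by (intro pd_cong L smooth_intros \<phi>)
  also have "\<dots> = dx (u 1) t * \<phi> t + q t * dx \<phi> t"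
    by (simp only: pd_rules \<phi> t) simp
  finally have L3: "dx (dx (dx \<phi>)) t = dx (u 1) t * \<phi> t + q t * dx \<phi> t" .
  have "dx (dx (W i \<phi>)) t = dx (\<lambda>s. 1/2 * (dx (A i) s * dx \<phi> s) + A i s * dx (dx \<phi>) s
      - 1/2 * (dx (dx (A i)) s * \<phi> s) - 2 * alpha_D i * dx \<phi> s) t"
    by (rule pd_cong[OF _ W1 t one_in(1)]) (intro smooth_intros \<phi>)
  also have "\<dots> = 3/2 * dx (A i) t * dx (dx \<phi>) t + A i t * dx (dx (dx \<phi>)) t
    - 1/2 * dx (dx (dx (A i))) t * \<phi> t - 2 * alpha_D i * dx (dx \<phi>) t"
    by (simp only: pd_rules \<phi> t) (simp add: algebra_simps)
  finally show ?thesis unfolding L3 L[OF t] by (simp add: mult.assoc)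
qed

text \<open>Given the Schroedinger equation, the \<open>i\<close>-th eigenvalue equation is the passage from
  \<open>i\<close> to \<open>i + 1\<close> in the family of flow equations \<open>\<partial>\<^bsub>i\<^esub>\<phi> = W i \<phi>\<close>.\<close>

lemma Uop_eigen_step:
  assumes \<phi>: "smooth e T \<phi>" and L: "\<And>t. t \<in> T \<Longrightarrow> dx (dx \<phi>) t = q t * \<phi> t"
    and i: "i \<in> {1..CARD('g)}" and W: "\<And>t. t \<in> T \<Longrightarrow> pd e i \<phi> t = W i \<phi> t" and t: "t \<in> T"
  shows "Uop e u i \<phi> t - \<alpha> i * \<phi> t = W (Suc i) \<phi> t - pd e (Suc i) \<phi> t"
proof -
  have sW: "smooth e T (W i \<phi>)"
    unfolding W_def[abs_def] by (intro smooth_intros \<phi>)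
  then have 1: "dx (pd e i \<phi>) s = dx (W i \<phi>) s" if "s \<in> T" for s
    using that W by (intro pd_cong one_in)
  have "dx (dx (pd e i \<phi>)) t = dx (dx (W i \<phi>)) t"
    by (rule pd_cong[OF _ 1 t one_in(1)]) (rule smooth_pd[OF sW one_in(1)])
  then have D3: "dx (dx (pd e i \<phi>)) t = 3/2 * dx (A i) t * q t * \<phi> t + A i t * (dx (u 1) t * \<phi> t + q t * dx \<phi> t)
    - 1/2 * dx (dx (dx (A i))) t * \<phi> t - 2 * alpha_D i * q t * \<phi> t"
    using dx2_W[OF \<phi> L t] by (rule trans)
  have "dx (A (Suc i)) t = dx (\<lambda>t. inverse \<xi> * A i t - 1/2 * u i t) t"
    by (intro pd_cong smooth_intros t i) (simp add: A_Suc[OF i] field_simps)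
  also have "\<dots> = inverse \<xi> * dx (A i) t - 1/2 * dx (u i) t"
    by (simp only: pd_rules i t) simp
  finally have A1: "dx (A (Suc i)) t = inverse \<xi> * dx (A i) t - 1/2 * dx (u i) t" .
  have A0: "A (Suc i) t = inverse \<xi> * A i t - 1/2 * u i t" and d: "alpha_D (Suc i) = inverse \<xi> * alpha_D i + 1/2 * \<alpha> i"
    by (simp_all add: A_Suc[OF i] alpha_D_Suc[OF i] field_simps)
  \<comment> \<open>The remaining algebra, with \<open>x\<close>, \<open>w\<close>,
    \<open>p\<close>, \<open>c\<close>, \<open>v\<close>, \<open>al\<close>, \<open>s\<close> for
    \<open>inverse \<xi>\<close>, \<open>u 1\<close>, \<open>\<phi>\<close>,
    \<open>dx (u 1)\<close>, \<open>u i\<close>, \<open>\<alpha> i\<close>,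
    \<open>pd e (Suc i) \<phi>\<close>. Its premise is \<open>dx_u\<close>; here the stationary
    equation enters.\<close>
  have identity: "3/2 * a' * (x + w) * p + a * (c * p + (x + w) * p') - 1/2 * a3 * p - 2 * d * (x + w) * p
      - w * (a * p' - 1/2 * (a' * p) - 2 * d * p) - 3/4 * v' * p - 1/2 * v * p' - s - al * p
    = (x * a - 1/2 * v) * p' - 1/2 * ((x * a' - 1/2 * v') * p) - 2 * (x * d + 1/2 * al) * p - s"
    if "v' = a * c + 2 * (x + w) * a' - a3 / 2" for a a' a3 x w p p' c d v v' s al :: complex
    unfolding that by (simp add: field_simps)
  show ?thesis
    unfolding Uop_eq[OF \<phi> t i] D3 W[OF t]
    unfolding W_def A0 A1 d by (rule identity[OF dx_u[OF t i]])
qed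

text \<open>The logarithmic derivatives of \<open>\<Phi>\<close>.\<close>

definition \<beta> :: "nat \<Rightarrow> 'k ^ 'g \<Rightarrow> complex" where
  "\<beta> i t = pd e i y t / (2 * y t) + 2 * alpha_xi * (A i t / y t) - 2 * alpha_D i"

lemma W_last:
  assumes "t \<in> T"
  shows "W (Suc CARD('g)) \<phi> t = (y t * dx \<phi> t - 1/2 * dx y t * \<phi> t - 2 * alpha_xi * \<phi> t) / (2 * \<xi> ^ CARD('g))"
proof -
  have "dx (A (Suc CARD('g))) t = dx (\<lambda>t. 1 / (2 * \<xi> ^ CARD('g)) * y t) t"
    using assms by (intro pd_cong smooth_intros) (simp add: A_last)
  also have "\<dots> = dx y t / (2 * \<xi> ^ CARD('g))"
    by (simp only: pd_rules assms) simp
  finally show ?thesis using xi by (simp add: W_def A_last alpha_D_last field_simps)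
qed

text \<open>After multiplication by \<open>y\<close> the first-order equation replaces
  \<open>y t * dx \<phi> t\<close>, and \<open>pd_y\<close> recognises the derivative of
  \<open>y\<close> in the result.\<close>

lemma W_eq_beta:
  assumes t: "t \<in> T" and i: "i \<in> {1..CARD('g)}"
    and \<phi>: "y t * dx \<phi> t - 1/2 * dx y t * \<phi> t - 2 * alpha_xi * \<phi> t = 0"
  shows "W i \<phi> t = \<beta> i t * \<phi> t"
proof -
  have 1: "y t * dx \<phi> t = 1/2 * dx y t * \<phi> t + 2 * alpha_xi * \<phi> t"
    using \<phi> by (simp add: algebra_simps)
  have "y t * W i \<phi> t = A i t * (y t * dx \<phi> t) - 1/2 * dx (A i) t * y t * \<phi> t - 2 * alpha_D i * y t * \<phi> t"
    by (simp add: W_def algebra_simps)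
  also have "\<dots> = y t * (\<beta> i t * \<phi> t)"
    unfolding 1 \<beta>_def pd_y[OF t i] using y_nonzero[OF t] by (simp add: field_simps)
  finally show ?thesis using y_nonzero[OF t] by simp
qed

lemma beta_1: "\<beta> 1 t = (dx y t + 4 * alpha_xi) / (2 * y t)"
  by (simp add: \<beta>_def A_1 alpha_D_1 add_divide_distrib)

lemma eigenfunction_imp_beta:
  assumes \<phi>: "\<phi> \<in> eigenspace e T u (inverse \<xi>) \<alpha>" and t: "t \<in> T" and i: "i \<in> {1..CARD('g)}"
  shows "pd e i \<phi> t = \<beta> i t * \<phi> t"
proof -
  have s: "smooth e T \<phi>" and L: "\<And>t. t \<in> T \<Longrightarrow> dx (dx \<phi>) t = q t * \<phi> t"
    and U: "\<And>i t. i \<in> {1..CARD('g)} \<Longrightarrow> t \<in> T \<Longrightarrow> Uop e u i \<phi> t = \<alpha> i * \<phi> t"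
    using \<phi> by (auto simp: eigenspace_def Lop_def algebra_simps)
  \<comment> \<open>Counting by \<open>Suc m\<close> lets the range reach \<open>i = g + 1\<close>.
    The base case \<open>i = 1\<close> is trivial, since \<open>A (Suc 0) t = 1\<close> and
    \<open>alpha_D (Suc 0) = 0\<close>.\<close>
  have W: "\<forall>t\<in>T. pd e (Suc m) \<phi> t = W (Suc m) \<phi> t" if "m \<le> CARD('g)" for m
    using that
  proof (induction m)
    case 0
    have "dx (A (Suc 0)) t = 0" if "t \<in> T" for t
      by (simp add: A_1[abs_def] pd_const)
    then show ?case by (simp add: W_def A_1 alpha_D_1)
  next
    case (Suc m)
    then have "Suc m \<in> {1..CARD('g)}" "\<And>t. t \<in> T \<Longrightarrow> pd e (Suc m) \<phi> t = W (Suc m) \<phi> t" by auto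
    from Uop_eigen_step[OF s L this] U[OF this(1)] show ?case by simp
  qed
  have "pd e (Suc CARD('g)) \<phi> t = 0" by (simp add: pd_def)
  then have "y t * dx \<phi> t - 1/2 * dx y t * \<phi> t - 2 * alpha_xi * \<phi> t = 0"
    using W[of "CARD('g)"] t xi by (simp add: W_last[OF t])
  from W_eq_beta[OF t i this] W[of "i - 1"] t i show ?thesis by (cases i) auto
qed

lemma smooth_beta: "i \<in> {1..CARD('g)} \<Longrightarrow> smooth e T (\<beta> i)"
  unfolding \<beta>_def[abs_def] by (intro smooth_intros smooth_divide) (auto simp: y_nonzero)

lemma beta_imp_eigenfunction:
  assumes \<alpha>: "\<And>t. t \<in> T \<Longrightarrow> 4 * alpha_xi\<^sup>2 = mu e u t \<xi>"
    and \<phi>: "\<And>t. t \<in> T \<Longrightarrow> kderiv e \<phi> (\<lambda>i. \<beta> i t * \<phi> t) t" "\<And>t. t \<notin> T \<Longrightarrow> \<phi> t = 0"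
  shows "\<phi> \<in> eigenspace e T u (inverse \<xi>) \<alpha>"
proof -
  have s: "smooth e T \<phi>" using \<phi>(1) smooth_beta by (rule smooth_logarithmic)
  have pd: "pd e i \<phi> t = \<beta> i t * \<phi> t" if "t \<in> T" "i \<in> {1..CARD('g)}" for i t
    using pd_eqI[OF \<phi>(1)[OF that(1)] that(2)] .
  have L: "dx (dx \<phi>) t = q t * \<phi> t" if t: "t \<in> T" for t
  proof -
    have "dx (dx \<phi>) t = dx (\<lambda>t. \<beta> 1 t * \<phi> t) t"
      using t by (intro pd_cong pd smooth_intros smooth_beta s)
    also have "\<dots> = (dx (\<beta> 1) t + (\<beta> 1 t)\<^sup>2) * \<phi> t"
      using pd_mult[OF t one_in(1) smooth_beta[OF one_in(1)] s] pd[OF t one_in(1)]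
      by (simp add: power2_eq_square algebra_simps)
    also have "dx (\<beta> 1) t = dx (\<lambda>t. (dx y t + 4 * alpha_xi) / (2 * y t)) t"
      unfolding beta_1[abs_def] ..
    also have "\<dots> = (dx (\<lambda>t. dx y t + 4 * alpha_xi) t * (2 * y t) - (dx y t + 4 * alpha_xi) * dx (\<lambda>t. 2 * y t) t) / (2 * y t)\<^sup>2"
      by (rule pd_divide[OF t one_in(1)]) (intro smooth_intros | simp add: y_nonzero)+
    also have "dx (\<lambda>t. dx y t + 4 * alpha_xi) t = dx (dx y) t"
      using pd_add[OF t one_in(1), of "dx y" "\<lambda>t. 4 * alpha_xi"] by (simp add: smooth_intros pd_const)
    also have "dx (\<lambda>t. 2 * y t) t = 2 * dx y t"
      by (rule pd_cmult[OF t one_in(1) smooth_y])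
    \<comment> \<open>In this Riccati expression the terms linear in \<open>alpha_xi\<close> cancel;
      only the square remains, and the condition on \<open>mu\<close> evaluates it.\<close>
    also have "(dx (dx y) t * (2 * y t) - (dx y t + 4 * alpha_xi) * (2 * dx y t)) / (2 * y t)\<^sup>2 + (\<beta> 1 t)\<^sup>2
        = (2 * dx (dx y) t * y t - (dx y t)\<^sup>2 + 4 * (4 * alpha_xi\<^sup>2)) / (4 * (y t)\<^sup>2)"
      unfolding beta_1 using y_nonzero[OF t] by (simp add: field_simps power2_eq_square)
    also have "\<dots> = q t"
      unfolding \<alpha>[OF t] mu_eq[OF t] using y_nonzero[OF t] by (simp add: field_simps)
    finally show ?thesis .
  qed
  have dx\<phi>: "y t * dx \<phi> t - 1/2 * dx y t * \<phi> t - 2 * alpha_xi * \<phi> t = 0" if t: "t \<in> T" for t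
    unfolding pd[OF t one_in(1)] beta_1 using y_nonzero[OF t] by (simp add: field_simps)
  \<comment> \<open>The range must include \<open>g + 1\<close>, because the \<open>i\<close>-th
    eigenvalue equation compares both sides at \<open>i + 1\<close>. At \<open>g + 1\<close> both
    sides are zero.\<close>
  have W: "pd e i \<phi> t = W i \<phi> t" if "t \<in> T" "i \<in> {1..Suc CARD('g)}" for i t
  proof (cases "i = Suc CARD('g)")
    case True
    then show ?thesis using dx\<phi>[OF that(1)] by (simp add: W_last[OF that(1)] pd_def)
  next
    case False
    then have "i \<in> {1..CARD('g)}" using that(2) by auto
    then show ?thesis using pd[OF that(1)] W_eq_beta[OF that(1) _ dx\<phi>[OF that(1)]] by simp
  qed
  have "Uop e u i \<phi> t = \<alpha> i * \<phi> t" if t: "t \<in> T" and i: "i \<in> {1..CARD('g)}" for i t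
  proof -
    have "Uop e u i \<phi> t - \<alpha> i * \<phi> t = W (Suc i) \<phi> t - pd e (Suc i) \<phi> t"
      using i by (intro Uop_eigen_step[OF s L i W t]) auto
    then show ?thesis using W[OF t, of "Suc i"] i by simp
  qed
  then show ?thesis
    using s \<phi>(2) L by (auto simp: eigenspace_def Lop_def algebra_simps)
qed

section \<open>The function \<open>\<Phi>\<close> and the eigenspace that it spans\<close>

lemma is_Phi_kderiv:
  assumes "is_Phi e T u \<xi> \<alpha> \<Phi>" and t: "t \<in> T"
  shows "kderiv e \<Phi> (\<lambda>i. \<beta> i t * \<Phi> t) t" and "\<Phi> t \<noteq> 0"
proof -
  obtain F r where F: "is_F e T u \<xi> F" and r: "continuous_on T r" "\<And>t. t \<in> T \<Longrightarrow> (r t)\<^sup>2 = y t"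
    and \<Phi>: "\<And>t. t \<in> T \<Longrightarrow> \<Phi> t = r t * exp (2 * alpha_xi * F t) * exp (- 2 * (\<Sum>i=1..CARD('g). alpha_D i * cplx (t $ e i)))"
    using assms(1) unfolding is_Phi_def alpha_xi_def alpha_D_def y_def by auto
  have sF: "smooth e T F" and pdF: "pd e i F t = A i t / y t" if "i \<in> {1..CARD('g)}" for i
    using F that t by (auto simp: is_F_def A_def y_def)
  \<comment> \<open>The root, the exponential of \<open>F\<close> and the exponential of the linear
    form contribute the three summands of \<open>\<beta>\<close>.\<close>
  let ?E = "\<lambda>t. 2 * alpha_xi * F t" and ?G = "\<lambda>t::'k^'g. - 2 * (\<Sum>i=1..CARD('g). alpha_D i * cplx (t $ e i))"
  have "kderiv e r (\<lambda>i. pd e i y t / (2 * y t) * r t) t"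
    by (rule kderiv_continuous_sqrt[OF smooth_kderiv[OF smooth_y t] t y_nonzero[OF t] r])
  moreover have "kderiv e (\<lambda>t. exp (?E t)) (\<lambda>i. (2 * alpha_xi * exp (?E t)) * pd e i F t) t"
    by (rule kderiv_chain[OF smooth_kderiv[OF sF[OF one_in(1)] t], of "\<lambda>z. exp (2 * alpha_xi * z)"])
       (auto intro!: derivative_eq_intros)
  moreover have "kderiv e (\<lambda>t. exp (?G t)) (\<lambda>i. (- 2 * exp (?G t)) * alpha_D i) t"
    by (rule kderiv_chain[OF kderiv_linear, of "\<lambda>z. exp (- 2 * z)"])
       (auto intro!: derivative_eq_intros)
  ultimately have k: "kderiv e (\<lambda>t. r t * exp (?E t) * exp (?G t))
     (\<lambda>i. (pd e i y t / (2 * y t) * r t * exp (?E t) + r t * ((2 * alpha_xi * exp (?E t)) * pd e i F t)) * exp (?G t)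
       + r t * exp (?E t) * ((- 2 * exp (?G t)) * alpha_D i)) t" (is "kderiv e _ ?b t")
    by (intro kderiv_mult)
  have alg: "(P * r * E + r * ((2 * a * E) * X)) * G + r * E * ((- 2 * G) * d) = (P + 2 * a * X - 2 * d) * (r * E * G)"
    for P r E a X G d :: complex
    by (simp add: algebra_simps)
  have "?b i = \<beta> i t * \<Phi> t" if "i \<in> {1..CARD('g)}" for i
    unfolding \<beta>_def \<Phi>[OF t] pdF[OF that] by (rule alg)
  then have "(\<Sum>i=1..CARD('g). ?b i * cplx (v $ e i)) = (\<Sum>i=1..CARD('g). \<beta> i t * \<Phi> t * cplx (v $ e i))" for v :: "'k^'g"
    by (intro sum.cong refl) (rule arg_cong[where f = "\<lambda>x. x * _"])
  with k have "kderiv e (\<lambda>t. r t * exp (?E t) * exp (?G t)) (\<lambda>i. \<beta> i t * \<Phi> t) t"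
    unfolding kderiv_def by simp
  then show "kderiv e \<Phi> (\<lambda>i. \<beta> i t * \<Phi> t) t"
    by (rule kderiv_transform[OF _ t]) (simp add: \<Phi>)
  show "\<Phi> t \<noteq> 0"
    using r(2)[OF t] y_nonzero[OF t] by (auto simp: \<Phi>[OF t])
qed

text \<open>Simple connectivity enters twice: for the primitive \<open>F\<close> and for the
  continuous branch of the square root of the nowhere vanishing \<open>y\<close>.\<close>

lemma is_Phi_exists:
  assumes T: "simply_connected T"
  shows "\<exists>\<Phi>. is_Phi e T u \<xi> \<alpha> \<Phi>"
proof -
  have sm: "smooth e T (\<lambda>t. A i t / y t)" for i
    by (rule smooth_divide[OF smooth_A smooth_y y_nonzero])
  obtain F where F: "smooth e T F" "\<And>t. t \<in> T \<Longrightarrow> kderiv e F (\<lambda>i. A i t / y t) t"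
    using closed_form_primitive[where b = "\<lambda>i t. A i t / y t", OF T sm closed_A_over_y] by blast
  have F': "is_F e T u \<xi> F"
    unfolding is_F_def using F(1) pd_eqI[OF F(2)] unfolding A_def y_def by blast
  obtain r where r: "continuous_on T r" "\<And>t. t \<in> T \<Longrightarrow> y t = (r t)\<^sup>2"
    using continuous_sqrt_on_simply_connected[OF smooth_continuous_on[OF smooth_y] T
        open_imp_locally_path_connected[OF open_T] y_nonzero] by blast
  have "\<forall>t\<in>T. (r t)\<^sup>2 = 2 - poly (U0 u t) \<xi>"
    using r(2) by (simp add: y_def)
  then show ?thesis
    unfolding is_Phi_def using F' r(1) by blast
qed

text \<open>An eigenfunction and \<open>\<Phi>\<close> solve the same linear first-order system, so
  their quotient has derivative zero and is constant on \<open>T\<close>. Both vanish off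
  \<open>T\<close>, which extends the equality to total functions.\<close>

lemma eigenspace_eq_span:
  assumes \<alpha>: "\<And>t. t \<in> T \<Longrightarrow> 4 * alpha_xi\<^sup>2 = mu e u t \<xi>" and T: "connected T" and \<Phi>: "is_Phi e T u \<xi> \<alpha> \<Phi>"
  shows "eigenspace e T u (inverse \<xi>) \<alpha> = cfun.span {\<Phi>}"
proof -
  have off: "\<Phi> t = 0" if "t \<notin> T" for t using \<Phi> that by (auto simp: is_Phi_def)
  have "cscale c \<Phi> \<in> eigenspace e T u (inverse \<xi>) \<alpha>" for c
  proof (rule beta_imp_eigenfunction[OF \<alpha>])
    show "kderiv e (cscale c \<Phi>) (\<lambda>i. \<beta> i t * cscale c \<Phi> t) t" if "t \<in> T" for t
      using kderiv_mult[OF kderiv_const[of e c t] is_Phi_kderiv(1)[OF \<Phi> that]]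
      by (simp add: cscale_def[abs_def] mult.left_commute)
  qed (simp_all add: cscale_def off)
  moreover have "\<exists>c. \<phi> = cscale c \<Phi>" if \<phi>: "\<phi> \<in> eigenspace e T u (inverse \<xi>) \<alpha>" for \<phi>
  \<comment> \<open>The constant is read off at a point of \<open>T\<close>; over the empty set the
    zero function is the only eigenfunction.\<close>
  proof (cases "T = {}")
    case True
    then show ?thesis using \<phi> by (auto simp: eigenspace_def cscale_def fun_eq_iff intro!: exI[of _ 0])
  next
    case False
    then obtain s where s: "s \<in> T" by blast
    have sm: "smooth e T \<phi>" and off': "\<And>t. t \<notin> T \<Longrightarrow> \<phi> t = 0" using \<phi> by (auto simp: eigenspace_def)
    have "kderiv e (\<lambda>t. \<phi> t * inverse (\<Phi> t)) (\<lambda>i. 0) t" if t: "t \<in> T" for t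
    proof -
      have nz: "\<Phi> t \<noteq> 0" by (rule is_Phi_kderiv(2)[OF \<Phi> t])
      have k: "kderiv e (\<lambda>t. \<phi> t * inverse (\<Phi> t))
        (\<lambda>i. pd e i \<phi> t * inverse (\<Phi> t) + \<phi> t * (- (inverse (\<Phi> t) * inverse (\<Phi> t)) * (\<beta> i t * \<Phi> t))) t" (is "kderiv e _ ?b t")
        by (rule kderiv_mult[OF smooth_kderiv[OF sm t] kderiv_inverse[OF is_Phi_kderiv(1)[OF \<Phi> t] nz]])
      have "?b i = 0" if "i \<in> {1..CARD('g)}" for i
        unfolding eigenfunction_imp_beta[OF \<phi> t that] using nz by simp
      then have "(\<Sum>i=1..CARD('g). ?b i * cplx (v $ e i)) = (\<Sum>i=1..CARD('g). 0 * cplx (v $ e i))" for v :: "'k^'g"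
        by (intro sum.cong refl) (rule arg_cong[where f = "\<lambda>x. x * _"])
      with k show ?thesis unfolding kderiv_def by simp
    qed
    then have const: "\<phi> t * inverse (\<Phi> t) = \<phi> s * inverse (\<Phi> s)" if "t \<in> T" for t
      using T s that by (intro kderiv_zero_constant)
    have "\<phi> = cscale (\<phi> s * inverse (\<Phi> s)) \<Phi>"
    proof
      fix t
      show "\<phi> t = cscale (\<phi> s * inverse (\<Phi> s)) \<Phi> t"
        using const[of t, symmetric] is_Phi_kderiv(2)[OF \<Phi>] off off' by (cases "t \<in> T") (simp_all add: cscale_def)
    qed
    then show ?thesis by blast
  qed
  ultimately show ?thesis unfolding cfun.span_singleton by blast
qed

end

end

text \<open>Since \<open>mu\<close> does not depend on time, the condition on
  \<open>\<alpha>\<close> is imposed at one point \<open>t0\<close>. Existence of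
  \<open>\<Phi>\<close> belongs to the conclusion, so that the assertion about every
  \<open>\<Phi>\<close> is not vacuous.\<close>

theorem theorem7p1:
  fixes e :: "nat \<Rightarrow> 'g::finite"
    and T :: "('k::time_scalar ^ 'g) set"
    and u :: "nat \<Rightarrow> 'k ^ 'g \<Rightarrow> complex"
    and \<xi> :: complex and \<alpha> :: "nat \<Rightarrow> complex"
    and t0 :: "'k ^ 'g"
  assumes e: "bij_betw e {1..CARD('g)} UNIV"
    and T: "open T" "T \<noteq> {}" "simply_connected T"
    and u_smooth: "\<forall>i\<in>{1..CARD('g)}. smooth e T (u i)"
    and stationary: "\<forall>t\<in>T. \<forall>\<zeta>. \<zeta> \<noteq> 0 \<longrightarrow>
          poly (U0 (\<lambda>i. pd e 1 (pd e 1 (pd e 1 (u i)))) t) \<zeta>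
          + 2 * pd e 1 (u 1) t * (2 - poly (U0 u t) \<zeta>)
          - 4 * (inverse \<zeta> + u 1 t) * poly (dU e 1 u t) \<zeta> = 0"
    and flow: "\<forall>k\<in>{1..CARD('g)}. \<forall>t\<in>T. \<forall>\<zeta>. \<zeta> \<noteq> 0 \<longrightarrow>
          poly (dU e k u t) \<zeta>
          = D k (2 - U0 u t) \<zeta> * poly (dU e 1 u t) \<zeta>
            - D k (dU e 1 u t) \<zeta> * (2 - poly (U0 u t) \<zeta>)"
    and xi: "\<xi> \<noteq> 0"
    and alpha: "t0 \<in> T" "4 * (poly (genpoly CARD('g) \<alpha>) \<xi>)^2 = mu e u t0 \<xi>"
    and nonzero: "\<forall>t\<in>T. 2 - poly (U0 u t) \<xi> \<noteq> 0"
  shows "(\<exists>\<Phi>. is_Phi e T u \<xi> \<alpha> \<Phi>)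
       \<and> (\<forall>\<Phi>. is_Phi e T u \<xi> \<alpha> \<Phi> \<longrightarrow> \<Phi> \<in> eigenspace e T u (inverse \<xi>) \<alpha> \<and> \<Phi> \<noteq> 0)
       \<and> cfun.subspace (eigenspace e T u (inverse \<xi>) \<alpha>)
       \<and> cfun.dim (eigenspace e T u (inverse \<xi>) \<alpha>) = 1"
proof -
  interpret kdv_flow e T u \<xi>
  proof unfold_locales
    fix t \<zeta> assume *: "t \<in> T" "(\<zeta>::complex) \<noteq> 0"
    show "poly (U0 (\<lambda>i. pd e 1 (pd e 1 (pd e 1 (u i)))) t) \<zeta>
          + 2 * pd e 1 (u 1) t * (2 - poly (U0 u t) \<zeta>)
          - 4 * (inverse \<zeta> + u 1 t) * poly (dU e 1 u t) \<zeta> = 0"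
      using stationary * by blast
    show "poly (dU e k u t) \<zeta> = D k (2 - U0 u t) \<zeta> * poly (dU e 1 u t) \<zeta>
            - D k (dU e 1 u t) \<zeta> * (2 - poly (U0 u t) \<zeta>)" if "k \<in> {1..CARD('g)}" for k
      using flow * that by blast
  qed (use e T u_smooth xi nonzero in blast)+
  have conn: "connected T" using T(3) by (rule simply_connected_imp_connected)
  have mu: "4 * (alpha_xi \<alpha>)\<^sup>2 = mu e u t \<xi>" if "t \<in> T" for t
    using alpha(2) mu_constant[OF conn alpha(1) that] by (simp add: alpha_xi_def)
  have span: "eigenspace e T u (inverse \<xi>) \<alpha> = cfun.span {\<Phi>}" if "is_Phi e T u \<xi> \<alpha> \<Phi>" for \<Phi>
    using mu conn that by (rule eigenspace_eq_span)
  have nz: "\<Phi> \<noteq> 0" if "is_Phi e T u \<xi> \<alpha> \<Phi>" for \<Phi>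
    using is_Phi_kderiv(2)[OF that alpha(1)] by auto
  obtain \<Phi> where \<Phi>: "is_Phi e T u \<xi> \<alpha> \<Phi>" using is_Phi_exists[OF T(3)] by blast
  have "cfun.independent {\<Phi>}" using nz[OF \<Phi>] by simp
  then have "cfun.dim (cfun.span {\<Phi>}) = card {\<Phi>}" by (rule cfun.dim_span_eq_card_independent)
  then show ?thesis
    using \<Phi> nz span cfun.span_base[of _ "{_}"] by (metis card_1_singleton_iff cfun.subspace_span insertI1 One_nat_def)
qed

end
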